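(* Let $M=(M_k)$ be a log-convex derivation closed weight sequence, let $p\in[1,\infty)$, and let $\ell,m,n$ be positive integers. Then: \begin{align*} f\in\mathcal B_{\ge1}(\mathbb R^m,\mathbb R^n),\ g\in W^{\infty,p}_{\ge1}(\mathbb R^\ell,\mathbb R^m)&\Longrightarrow f\circ g\in W^{\infty,p}_{\ge1}(\mathbb R^\ell,\mathbb R^n),\\ f\in\mathcal B^{[M]}_{\ge1}(\mathbb R^m,\mathbb R^n),\ g\in W^{[M],p}_{\ge1}(\mathbb R^\ell,\mathbb R^m)&\Longrightarrow f\circ g\in W^{[M],p}_{\ge1}(\mathbb R^\ell,\mathbb R^n), \end{align*} where $[M]$ stands either for $(M)$ throughout or for $\{M\}$ throughout; the statement holds in both cases.
   Context: A weight sequence is a sequence $M=(M_k)_{k\in\mathbb N}$, $\mathbb N=\{0,1,\dots\}$, of positive reals with $M_0=1\le M_1$; it is log-convex if $M_k^2\le M_{k-1}M_{k+1}$ for $k\ge1$, and derivation closed if $\sup_{k\ge1}(M_{k+1}/M_k)^{1/k}<\infty$. $\mathcal B_{\ge1}(\mathbb R^m,\mathbb R^n)$: all $f\in C^\infty(\mathbb R^m,\mathbb R^n)$ with $\sup_x\|f^{(k)}(x)\|<\infty$ for all $k\ge1$ ($f^{(k)}$ the $k$-th Fréchet derivative). $\mathcal B^{(M)}_{\ge1}$ (resp. $\mathcal B^{\{M\}}_{\ge1}$): all $f\in C^\infty(\mathbb R^m,\mathbb R^n)$ such that for all (resp. some) $\rho>0$, $\sup_{k\ge1,x}\frac{\|f^{(k)}(x)\|}{\rho^kk!M_k}<\infty$.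 $W^{\infty,p}_{\ge1}(\mathbb R^m)$: all $f\in C^\infty(\mathbb R^m)$ with $\|f^{(\alpha)}\|_{L^p(\mathbb R^m)}<\infty$ for all $\alpha\in\mathbb N^m$ with $|\alpha|\ge1$. $W^{(M),p}_{\ge1}(\mathbb R^m)$ (resp. $W^{\{M\},p}_{\ge1}(\mathbb R^m)$): all $f\in C^\infty(\mathbb R^m)$ such that for all (resp. some) $\sigma>0$, $\sup_{\alpha\in\mathbb N^m,|\alpha|\ge1}\frac{\|f^{(\alpha)}\|_{L^p(\mathbb R^m)}}{\sigma^{|\alpha|}|\alpha|!M_{|\alpha|}}<\infty$. For values in $\mathbb R^n$ the conditions are imposed on each component. *)

theory Defs
  imports "HOL-Analysis.Analysis"
begin

(* The k-th Frechet derivative of f, evaluated on vectors: for vs = [v_1, ..., v_k],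
   iter_frechet f vs x is f^(k)(x)(v_1, ..., v_k), using the usual identification
   f^(k+1)(x)(v_1, ..., v_{k+1}) = (D f^(k)(x) v_1)(v_2, ..., v_{k+1}). Since the domain is
   finite-dimensional, differentiating the map y |-> f^(k)(y) into the k-linear maps is the same
   as differentiating y |-> f^(k)(y)(v_2, ..., v_{k+1}) for all vectors v_2, ..., v_{k+1}. *)

primrec iter_frechet ::
  "('a::euclidean_space \<Rightarrow> 'b::real_normed_vector) \<Rightarrow> 'a list \<Rightarrow> 'a \<Rightarrow> 'b" where
  "iter_frechet f [] = f"
| "iter_frechet f (v # vs) = (\<lambda>x. frechet_derivative (iter_frechet f vs) (at x) v)"

(* Continuity of all derivatives is implied, since each of them is differentiable. *)

definition smooth :: "('a::euclidean_space \<Rightarrow> 'b::real_normed_vector) \<Rightarrow> bool" where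
  "smooth f \<longleftrightarrow> (\<forall>vs x. iter_frechet f vs differentiable (at x))"

(* Norm of f^(k)(x) as a k-linear map. For smooth f the supremum is over a bounded set. *)

definition frechet_norm ::
  "nat \<Rightarrow> ('a::euclidean_space \<Rightarrow> 'b::real_normed_vector) \<Rightarrow> 'a \<Rightarrow> real" where
  "frechet_norm k f x =
     (SUP vs \<in> {vs. length vs = k \<and> (\<forall>v\<in>set vs. norm v \<le> 1)}. norm (iter_frechet f vs x))"

definition mi_abs :: "nat ^ 'm \<Rightarrow> nat" where
  "mi_abs \<alpha> = (\<Sum>i\<in>UNIV. \<alpha> $ i)"

(* The coordinates carry no order, so some order of the partial derivatives is chosen;
   for smooth f the result does not depend on it, by the symmetry of f^(k)(x). *)

definition mi_list :: "nat ^ 'm \<Rightarrow> 'm list" where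
  "mi_list \<alpha> = (SOME is. \<forall>i. count_list is i = \<alpha> $ i)"

definition partial_deriv ::
  "nat ^ 'm \<Rightarrow> (real ^ 'm \<Rightarrow> 'b::real_normed_vector) \<Rightarrow> real ^ 'm \<Rightarrow> 'b" where
  "partial_deriv \<alpha> f = iter_frechet f (map (\<lambda>i. axis i 1) (mi_list \<alpha>))"

definition Lp_finite :: "real \<Rightarrow> ('a::euclidean_space \<Rightarrow> real) \<Rightarrow> bool" where
  "Lp_finite p f \<longleftrightarrow> integrable lborel (\<lambda>x. \<bar>f x\<bar> powr p)"

(* Meaningful only for Lp_finite p f: the Bochner integral of a non-integrable function is 0. *)

definition Lp_norm :: "real \<Rightarrow> ('a::euclidean_space \<Rightarrow> real) \<Rightarrow> real" where
  "Lp_norm p f = (LINT x|lborel. \<bar>f x\<bar> powr p) powr (1 / p)"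

definition weight_sequence :: "(nat \<Rightarrow> real) \<Rightarrow> bool" where
  "weight_sequence M \<longleftrightarrow> (\<forall>k. 0 < M k) \<and> M 0 = 1 \<and> 1 \<le> M 1"

definition log_convex :: "(nat \<Rightarrow> real) \<Rightarrow> bool" where
  "log_convex M \<longleftrightarrow> (\<forall>k\<ge>1. (M k)\<^sup>2 \<le> M (k - 1) * M (k + 1))"

definition derivation_closed :: "(nat \<Rightarrow> real) \<Rightarrow> bool" where
  "derivation_closed M \<longleftrightarrow>
     bdd_above ((\<lambda>k. (M (k + 1) / M k) powr (1 / real k)) ` {1..})"

definition B_ge1 :: "(real ^ 'm \<Rightarrow> real ^ 'n) set" where
  "B_ge1 = {f. smooth f \<and> (\<forall>k\<ge>1. bdd_above (range (frechet_norm k f)))}"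

definition B_bounded :: "(nat \<Rightarrow> real) \<Rightarrow> real \<Rightarrow> (real ^ 'm \<Rightarrow> real ^ 'n) \<Rightarrow> bool" where
  "B_bounded M \<rho> f \<longleftrightarrow>
     bdd_above {frechet_norm k f x / (\<rho> ^ k * fact k * M k) | k x. 1 \<le> k}"

definition B_Beurling_ge1 :: "(nat \<Rightarrow> real) \<Rightarrow> (real ^ 'm \<Rightarrow> real ^ 'n) set" where
  "B_Beurling_ge1 M = {f. smooth f \<and> (\<forall>\<rho>>0. B_bounded M \<rho> f)}"

definition B_Roumieu_ge1 :: "(nat \<Rightarrow> real) \<Rightarrow> (real ^ 'm \<Rightarrow> real ^ 'n) set" where
  "B_Roumieu_ge1 M = {f. smooth f \<and> (\<exists>\<rho>>0. B_bounded M \<rho> f)}"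

definition W_inf_ge1 :: "real \<Rightarrow> (real ^ 'm \<Rightarrow> real) set" where
  "W_inf_ge1 p = {f. smooth f \<and> (\<forall>\<alpha>. 1 \<le> mi_abs \<alpha> \<longrightarrow> Lp_finite p (partial_deriv \<alpha> f))}"

definition W_bounded :: "(nat \<Rightarrow> real) \<Rightarrow> real \<Rightarrow> real \<Rightarrow> (real ^ 'm \<Rightarrow> real) \<Rightarrow> bool" where
  "W_bounded M p \<sigma> f \<longleftrightarrow>
     (\<forall>\<alpha>. 1 \<le> mi_abs \<alpha> \<longrightarrow> Lp_finite p (partial_deriv \<alpha> f)) \<and>
     bdd_above {Lp_norm p (partial_deriv \<alpha> f) /
       (\<sigma> ^ mi_abs \<alpha> * fact (mi_abs \<alpha>) * M (mi_abs \<alpha>)) | \<alpha>. 1 \<le> mi_abs \<alpha>}"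

definition W_Beurling_ge1 :: "(nat \<Rightarrow> real) \<Rightarrow> real \<Rightarrow> (real ^ 'm \<Rightarrow> real) set" where
  "W_Beurling_ge1 M p = {f. smooth f \<and> (\<forall>\<sigma>>0. W_bounded M p \<sigma> f)}"

definition W_Roumieu_ge1 :: "(nat \<Rightarrow> real) \<Rightarrow> real \<Rightarrow> (real ^ 'm \<Rightarrow> real) set" where
  "W_Roumieu_ge1 M p = {f. smooth f \<and> (\<exists>\<sigma>>0. W_bounded M p \<sigma> f)}"

definition componentwise :: "(real ^ 'm \<Rightarrow> real) set \<Rightarrow> (real ^ 'm \<Rightarrow> real ^ 'n) set" where
  "componentwise W = {f. \<forall>i. (\<lambda>x. f x $ i) \<in> W}"

end

theory Submission
  imports Defs "HOL-Library.Multiset"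
begin

text \<open>
  A Sobolev inequality on unit cubes, obtained by applying the one-dimensional bound
  $|u(0)| \le \int_0^1 |u| + |u'|$ in each coordinate direction in turn, makes all derivatives of
  \<open>g\<close> of order at least one bounded; derivation closedness absorbs the loss of at most
  $\ell$ derivatives. Every term of a derivative of \<open>f \<circ> g\<close> contains a factor $\partial^\beta g_j$ with
  $|\beta| \ge 1$, which is estimated in $L^p$, the other factors being estimated in $L^\infty$. Instead of
  Faa di Bruno's formula, the chain rule $\partial_i(F \circ g) = \sum_j (\partial_j F \circ g)\, \partial_i g_j$ and
  the Leibniz rule give a recursion for majorants of the derivatives of $\partial^\gamma F \circ g$, which is
  solved using $M_a M_b \le M_1 M_{a+b-1}$.
\<close>

section \<open>Smooth functions\<close>

text \<open>Neither \<open>f\<close> nor \<open>g\<close> itself need be bounded or integrable, so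
  only derivatives of order at least one may be estimated. The first chain rule step is therefore
  treated apart: it turns \<open>F\<close> into its first derivatives, and the factor it splits off,
  a derivative of a component of \<open>g\<close>, is the one that is measured in L^p; all later
  factors are bounded.

  A derivative of order k + 1 of (a derivative of order s) \<circ> g leads to derivatives of order r
  of (a derivative of order s + 1) \<circ> g, times derivatives of \<open>g\<close> of order k - r +
  1. The weight indices add up to s + k + 2, one more than the order s + k + 1 to be reached; hence
  the product estimate that gains one index at the price of M_1.

  The Sobolev loss of e derivatives costs a factor H^(e (k + e)). As e is at most the dimension,
  this is geometric in k and only enlarges the radius by a constant factor.

  The resulting radius is a constant times \<sigma> (2 + K \<rho>), where K depends on
  \<open>g\<close> and \<sigma> but not on \<open>f\<close> and \<rho>. In the Beurling case
  \<sigma> is thus fixed before K, and \<rho> = 1/K comes last.\<close>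

lemma iter_frechet_append: "iter_frechet f (us @ vs) = iter_frechet (iter_frechet f vs) us"
  by (induction us) simp_all

lemma iter_frechet_Cons: "iter_frechet f (v # vs) = iter_frechet (iter_frechet f vs) [v]"
  by simp

lemma smooth_iter_frechet: "smooth f \<Longrightarrow> smooth (iter_frechet f vs)"
  by (simp add: smooth_def iter_frechet_append [symmetric])

lemma smooth_imp_differentiable: "smooth f \<Longrightarrow> f differentiable (at x)"
  by (metis smooth_def iter_frechet.simps(1))

lemma smooth_imp_has_derivative:
  "smooth f \<Longrightarrow> (f has_derivative (\<lambda>v. iter_frechet f [v] x)) (at x)"
  by (simp add: smooth_imp_differentiable frechet_derivative_works [symmetric] eta_contract_eq)

lemma iter_frechet_singleton_eqI:
  assumes "\<And>x. (f has_derivative f' x) (at x)"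
  shows "iter_frechet f [v] = (\<lambda>x. f' x v)"
  using frechet_derivative_at [OF assms] by (simp add: fun_eq_iff)

lemma smooth_imp_continuous: "smooth f \<Longrightarrow> continuous_on S f"
  by (meson continuous_at_imp_continuous_on differentiable_imp_continuous_within smooth_imp_differentiable)

lemma smooth_imp_borel [measurable_dest]:
  fixes f :: "'a::euclidean_space \<Rightarrow> real"
  shows "smooth f \<Longrightarrow> f \<in> borel_measurable borel"
  by (intro borel_measurable_continuous_onI smooth_imp_continuous)

declare iter_frechet.simps(2) [simp del]

text \<open>A finite order permits induction with the function left arbitrary, as is necessary
  because differentiating a product or a composition produces other functions. The order is shifted
  by one: \<open>differentiable_upto n\<close> means n + 1 times differentiable.\<close>

definition differentiable_upto :: "nat \<Rightarrow> ('a::euclidean_space \<Rightarrow> 'b::real_normed_vector) \<Rightarrow> bool" where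
  "differentiable_upto n f \<longleftrightarrow> (\<forall>vs x. length vs \<le> n \<longrightarrow> iter_frechet f vs differentiable (at x))"

lemma smooth_iff_differentiable_upto: "smooth f \<longleftrightarrow> (\<forall>n. differentiable_upto n f)"
  by (auto simp: smooth_def differentiable_upto_def)

lemma differentiable_upto_0: "differentiable_upto 0 f \<longleftrightarrow> (\<forall>x. f differentiable (at x))"
  by (simp add: differentiable_upto_def)

text \<open>The innermost derivative is split off, that is, the last list entry, so that what
  remains concerns the derivatives of the new function \<open>iter_frechet f [v]\<close>.\<close>

lemma differentiable_upto_Suc:
  "differentiable_upto (Suc n) f \<longleftrightarrow>
     (\<forall>x. f differentiable (at x)) \<and> (\<forall>v. differentiable_upto n (iter_frechet f [v]))"
proof (intro iffI conjI allI)
  show "f differentiable (at x)" if "differentiable_upto (Suc n) f" for x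
    using that by (auto simp: differentiable_upto_def dest: spec [of _ "[]"])
  show "differentiable_upto n (iter_frechet f [v])" if "differentiable_upto (Suc n) f" for v
    unfolding differentiable_upto_def iter_frechet_append [symmetric]
    using that by (auto simp: differentiable_upto_def)
next
  assume R: "(\<forall>x. f differentiable (at x)) \<and> (\<forall>v. differentiable_upto n (iter_frechet f [v]))"
  show "differentiable_upto (Suc n) f"
    unfolding differentiable_upto_def
  proof (intro allI impI)
    fix vs :: "'a list" and x assume l: "length vs \<le> Suc n"
    show "iter_frechet f vs differentiable (at x)"
    proof (cases vs rule: rev_cases)
      case Nil then show ?thesis using R by simp
    next
      case (snoc ws v)
      then show ?thesis
        using R l unfolding differentiable_upto_def by (simp add: iter_frechet_append)
    qed
  qed
qed

lemma iter_frechet_add: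
  assumes "\<And>x. f differentiable (at x)" "\<And>x. g differentiable (at x)"
  shows "iter_frechet (\<lambda>x. f x + g x) [v] = (\<lambda>x. iter_frechet f [v] x + iter_frechet g [v] x)"
proof -
  have "((\<lambda>x. f x + g x) has_derivative (\<lambda>v. iter_frechet f [v] x + iter_frechet g [v] x)) (at x)" for x
    using assms by (auto simp: frechet_derivative_works iter_frechet.simps(2) intro!: derivative_eq_intros)
  then show ?thesis by (rule iter_frechet_singleton_eqI)
qed

lemma iter_frechet_mult:
  fixes f g :: "'a::euclidean_space \<Rightarrow> real"
  assumes "\<And>x. f differentiable (at x)" "\<And>x. g differentiable (at x)"
  shows "iter_frechet (\<lambda>x. f x * g x) [v] = (\<lambda>x. iter_frechet f [v] x * g x + f x * iter_frechet g [v] x)"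
proof -
  have "((\<lambda>x. f x * g x) has_derivative (\<lambda>v. iter_frechet f [v] x * g x + f x * iter_frechet g [v] x)) (at x)" for x
    using assms by (auto simp: frechet_derivative_works iter_frechet.simps(2) intro!: derivative_eq_intros)
  then show ?thesis by (rule iter_frechet_singleton_eqI)
qed

lemma differentiable_upto_add:
  "differentiable_upto n f \<Longrightarrow> differentiable_upto n g \<Longrightarrow> differentiable_upto n (\<lambda>x. f x + g x)"
proof (induction n arbitrary: f g)
  case 0
  then show ?case by (simp add: differentiable_upto_0)
next
  case (Suc n)
  then show ?case by (simp add: differentiable_upto_Suc iter_frechet_add)
qed

lemma differentiable_upto_const: "differentiable_upto n (\<lambda>x. c)"
proof (induction n arbitrary: c)
  case 0
  then show ?case by (simp add: differentiable_upto_0)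
next
  case (Suc n)
  have "iter_frechet (\<lambda>x. c) [v] = (\<lambda>x. 0)" for v :: 'a
    by (rule iter_frechet_singleton_eqI) simp
  with Suc show ?case by (simp add: differentiable_upto_Suc)
qed

lemma differentiable_upto_sum:
  "finite I \<Longrightarrow> (\<And>i. i \<in> I \<Longrightarrow> differentiable_upto n (f i)) \<Longrightarrow> differentiable_upto n (\<lambda>x. \<Sum>i\<in>I. f i x)"
  by (induction I rule: finite_induct)
     (simp_all add: differentiable_upto_add differentiable_upto_const)

lemma differentiable_upto_mono: "differentiable_upto n f \<Longrightarrow> k \<le> n \<Longrightarrow> differentiable_upto k f"
  by (auto simp: differentiable_upto_def)

lemma differentiable_upto_mult:
  fixes f g :: "'a::euclidean_space \<Rightarrow> real"
  shows "differentiable_upto n f \<Longrightarrow> differentiable_upto n g \<Longrightarrow> differentiable_upto n (\<lambda>x. f x * g x)"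
proof (induction n arbitrary: f g)
  case 0
  then show ?case by (simp add: differentiable_upto_0)
next
  case (Suc n)
  then have "differentiable_upto n f" "differentiable_upto n g"
    by (auto intro: differentiable_upto_mono)
  with Suc show ?case
    by (simp add: differentiable_upto_Suc iter_frechet_mult differentiable_upto_add)
qed

lemma smooth_mult:
  fixes f g :: "'a::euclidean_space \<Rightarrow> real"
  shows "smooth f \<Longrightarrow> smooth g \<Longrightarrow> smooth (\<lambda>x. f x * g x)"
  by (simp add: smooth_iff_differentiable_upto differentiable_upto_mult)

lemma iter_frechet_sum:
  assumes "finite I" "\<And>i. i \<in> I \<Longrightarrow> smooth (f i)"
  shows "iter_frechet (\<lambda>x. \<Sum>i\<in>I. f i x) vs = (\<lambda>x. \<Sum>i\<in>I. iter_frechet (f i) vs x)"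
proof (induction vs)
  case (Cons v vs)
  have "((\<lambda>x. \<Sum>i\<in>I. iter_frechet (f i) vs x) has_derivative
          (\<lambda>v. \<Sum>i\<in>I. iter_frechet (f i) (v # vs) x)) (at x)" for x
    using assms smooth_imp_has_derivative [OF smooth_iter_frechet, of "f _" vs x]
    by (intro has_derivative_sum) (simp add: iter_frechet_Cons [symmetric])
  from iter_frechet_singleton_eqI [OF this, of v] show ?case
    by (simp add: iter_frechet_Cons [of _ v vs] Cons.IH)
qed simp

lemma iter_frechet_bounded_linear:
  assumes "smooth f" "bounded_linear L"
  shows "iter_frechet (\<lambda>x. L (f x)) vs = (\<lambda>x. L (iter_frechet f vs x))"
proof (induction vs)
  case (Cons v vs)
  have "((\<lambda>x. L (iter_frechet f vs x)) has_derivative (\<lambda>v. L (iter_frechet f (v # vs) x))) (at x)" for x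
    using smooth_imp_has_derivative [OF smooth_iter_frechet [OF assms(1)], of vs x]
      bounded_linear.has_derivative [OF assms(2)]
    by (force simp: iter_frechet_Cons [symmetric])
  from iter_frechet_singleton_eqI [OF this, of v] show ?case
    by (simp add: iter_frechet_Cons [of _ v vs] Cons.IH)
qed simp

lemma smooth_bounded_linear:
  assumes "smooth f" "bounded_linear L"
  shows "smooth (\<lambda>x. L (f x))"
  unfolding smooth_def iter_frechet_bounded_linear [OF assms]
  using bounded_linear.has_derivative [OF assms(2)] assms(1)
  unfolding smooth_def differentiable_def by blast

text \<open>The chain rule is put in coordinates because the conditions on \<open>g\<close> are
  componentwise and because a sum of products of real functions can be differentiated again.\<close>

lemma iter_frechet_compose:
  fixes F :: "'b::euclidean_space \<Rightarrow> real" and g :: "'a::euclidean_space \<Rightarrow> 'b"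
  assumes "smooth F" "\<And>j. j \<in> Basis \<Longrightarrow> smooth (\<lambda>x. g x \<bullet> j)"
  shows "iter_frechet (\<lambda>x. F (g x)) [v] =
    (\<lambda>x. \<Sum>j\<in>Basis. iter_frechet F [j] (g x) * iter_frechet (\<lambda>x. g x \<bullet> j) [v] x)"
    and "(\<lambda>x. F (g x)) differentiable (at x)"
proof -
  \<comment> \<open>The total derivative of \<open>g\<close>, assembled from its coordinates, the
    only functions assumed smooth.\<close>
  define G' where "G' = (\<lambda>x v. \<Sum>j\<in>Basis. iter_frechet (\<lambda>x. g x \<bullet> j) [v] x *\<^sub>R j)"
  have G: "(g has_derivative G' x) (at x)" for x
    unfolding has_derivative_componentwise_within [of g] G'_def
    using assms(2) smooth_imp_has_derivative
    by (force simp: inner_sum_left inner_Basis if_distrib cong: if_cong)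
  have lin: "linear (\<lambda>v. iter_frechet F [v] y)" for y
    using smooth_imp_has_derivative [OF assms(1)] has_derivative_linear by blast
  have FG: "((\<lambda>x. F (g x)) has_derivative (\<lambda>v. iter_frechet F [G' x v] (g x))) (at x)" for x
    using diff_chain_at [OF G smooth_imp_has_derivative [OF assms(1)]] by (simp add: comp_def)
  then show "(\<lambda>x. F (g x)) differentiable (at x)" by (auto simp: differentiable_def)
  show "iter_frechet (\<lambda>x. F (g x)) [v] =
    (\<lambda>x. \<Sum>j\<in>Basis. iter_frechet F [j] (g x) * iter_frechet (\<lambda>x. g x \<bullet> j) [v] x)"
    unfolding iter_frechet_singleton_eqI [OF FG]
    unfolding G'_def linear_sum [OF lin] linear_cmul [OF lin]
    by (simp add: mult.commute)
qed

text \<open>The derivative is made of compositions of \<open>iter_frechet F [j]\<close> with the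
  same \<open>g\<close>, so the induction on the order varies \<open>F\<close> and keeps
  \<open>g\<close>.\<close>

lemma smooth_compose:
  fixes F :: "'b::euclidean_space \<Rightarrow> real" and g :: "'a::euclidean_space \<Rightarrow> 'b"
  assumes "smooth F" and g: "\<And>j. j \<in> Basis \<Longrightarrow> smooth (\<lambda>x. g x \<bullet> j)"
  shows "smooth (\<lambda>x. F (g x))"
proof -
  have "differentiable_upto n (\<lambda>x. F (g x))" for n
    using assms(1)
  proof (induction n arbitrary: F)
    case 0
    then show ?case using iter_frechet_compose(2) [OF _ g] by (simp add: differentiable_upto_0)
  next
    case (Suc n)
    have "differentiable_upto n (iter_frechet (\<lambda>x. g x \<bullet> j) [v])" if "j \<in> Basis" for j v
      using smooth_iter_frechet [OF g [OF that]] by (simp only: smooth_iff_differentiable_upto)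
    then have "differentiable_upto n (\<lambda>x. \<Sum>j\<in>Basis. iter_frechet F [j] (g x) * iter_frechet (\<lambda>x. g x \<bullet> j) [v] x)" for v
      by (intro differentiable_upto_sum differentiable_upto_mult finite_Basis)
         (auto intro: Suc.IH [OF smooth_iter_frechet [OF Suc.prems]])
    then show ?case
      using iter_frechet_compose [OF Suc.prems g] by (simp add: differentiable_upto_Suc)
  qed
  then show ?thesis by (simp add: smooth_iff_differentiable_upto)
qed

section \<open>Symmetry of iterated derivatives\<close>

lemma has_real_derivative_along_line:
  fixes u :: "'a::euclidean_space \<Rightarrow> real"
  assumes "smooth u"
  shows "((\<lambda>s. u (y + s *\<^sub>R v)) has_real_derivative iter_frechet u [v] (y + s *\<^sub>R v)) (at s)"
proof -
  have "linear (\<lambda>v. iter_frechet u [v] z)" for z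
    using smooth_imp_has_derivative [OF assms] has_derivative_linear by blast
  then have *: "iter_frechet u [d *\<^sub>R v] z = d * iter_frechet u [v] z" for d z
    by (simp add: linear_cmul [where f = "\<lambda>v. iter_frechet u [v] _"])
  have "((\<lambda>s. y + s *\<^sub>R v) has_derivative (\<lambda>d. d *\<^sub>R v)) (at s)"
    by (auto intro!: derivative_eq_intros)
  from diff_chain_at [OF this smooth_imp_has_derivative [OF assms]] show ?thesis
    by (simp add: comp_def * has_field_derivative_def mult_commute_abs)
qed

text \<open>The mean value theorem in direction \<open>v\<close>, applied to the difference in
  direction \<open>w\<close>, and once more in direction \<open>w\<close>. The left side is
  symmetric in \<open>v\<close> and \<open>w\<close>, the right side is not, and this asymmetry is
  what yields the symmetry of second derivatives.\<close>

lemma second_difference_mvt: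
  fixes u :: "'a::euclidean_space \<Rightarrow> real"
  assumes u: "smooth u" and h: "0 < h"
  obtains s t where "0 < s" "s < h" "0 < t" "t < h"
    "u (x + h *\<^sub>R v + h *\<^sub>R w) - u (x + h *\<^sub>R v) - u (x + h *\<^sub>R w) + u x
       = h\<^sup>2 * iter_frechet u [w, v] (x + s *\<^sub>R v + t *\<^sub>R w)"
proof -
  define \<phi> where "\<phi> = (\<lambda>s. u ((x + h *\<^sub>R w) + s *\<^sub>R v) - u (x + s *\<^sub>R v))"
  define \<phi>' where "\<phi>' = (\<lambda>s. iter_frechet u [v] ((x + h *\<^sub>R w) + s *\<^sub>R v) - iter_frechet u [v] (x + s *\<^sub>R v))"
  have "(\<phi> has_real_derivative \<phi>' s) (at s)" for s
    unfolding \<phi>_def \<phi>'_def by (intro DERIV_diff has_real_derivative_along_line u)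
  then obtain s where s: "0 < s" "s < h" "\<phi> h - \<phi> 0 = (h - 0) * \<phi>' s"
    using MVT2 [OF h, of \<phi> \<phi>'] by blast
  have "((\<lambda>t. iter_frechet u [v] ((x + s *\<^sub>R v) + t *\<^sub>R w)) has_real_derivative
         iter_frechet (iter_frechet u [v]) [w] ((x + s *\<^sub>R v) + t *\<^sub>R w)) (at t)" for t
    by (intro has_real_derivative_along_line smooth_iter_frechet u)
  from MVT2 [OF h this] obtain t where t: "0 < t" "t < h"
    "iter_frechet u [v] ((x + s *\<^sub>R v) + h *\<^sub>R w) - iter_frechet u [v] ((x + s *\<^sub>R v) + 0 *\<^sub>R w)
      = (h - 0) * iter_frechet (iter_frechet u [v]) [w] ((x + s *\<^sub>R v) + t *\<^sub>R w)"
    by blast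
  then have "\<phi>' s = h * iter_frechet u [w, v] (x + s *\<^sub>R v + t *\<^sub>R w)"
    by (simp add: \<phi>'_def iter_frechet_Cons [of _ w "[v]"] algebra_simps)
  with s show thesis
    by (intro that [OF s(1,2) t(1,2)]) (simp add: \<phi>_def algebra_simps power2_eq_square)
qed

text \<open>Schwarz's theorem: one and the same second difference quotient converges to both mixed
  derivatives.\<close>

lemma iter_frechet_swap:
  fixes u :: "'a::euclidean_space \<Rightarrow> real"
  assumes u: "smooth u"
  shows "iter_frechet u [v, w] = iter_frechet u [w, v]"
proof
  fix x
  define Q where "Q = (\<lambda>v w h. (u (x + h *\<^sub>R v + h *\<^sub>R w) - u (x + h *\<^sub>R v) - u (x + h *\<^sub>R w) + u x) / h\<^sup>2)"
  have lim: "(\<lambda>n. Q v w (1 / real (Suc n))) \<longlonglongrightarrow> iter_frechet u [w, v] x" for v w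
  proof -
    \<comment> \<open>The intermediate point of the two mean value theorems lies within (norm v +
      norm w) h of \<open>x\<close>, with h = 1/(n + 1), and hence tends to
      \<open>x\<close>.\<close>
    have "\<exists>y. dist y x \<le> (norm v + norm w) * (1 / real (Suc n)) \<and> Q v w (1 / real (Suc n)) = iter_frechet u [w, v] y" for n
    proof -
      define h where "h = 1 / real (Suc n)"
      have h: "0 < h" by (simp add: h_def)
      from second_difference_mvt [OF u h, of x v w] obtain s t where
        st: "0 < s" "s < h" "0 < t" "t < h" and
        eq: "u (x + h *\<^sub>R v + h *\<^sub>R w) - u (x + h *\<^sub>R v) - u (x + h *\<^sub>R w) + u x
          = h\<^sup>2 * iter_frechet u [w, v] (x + s *\<^sub>R v + t *\<^sub>R w)" .
      have "dist (x + s *\<^sub>R v + t *\<^sub>R w) x \<le> norm (s *\<^sub>R v) + norm (t *\<^sub>R w)"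
        by (simp add: dist_norm add.assoc norm_triangle_ineq del: norm_scaleR)
      also have "\<dots> \<le> h * norm v + h * norm w"
        using st by (auto intro!: add_mono mult_right_mono)
      finally have "dist (x + s *\<^sub>R v + t *\<^sub>R w) x \<le> (norm v + norm w) * h"
        by (simp add: algebra_simps)
      moreover have "Q v w h = iter_frechet u [w, v] (x + s *\<^sub>R v + t *\<^sub>R w)"
        using h unfolding Q_def eq by simp
      ultimately show ?thesis unfolding h_def by blast
    qed
    then have "\<exists>y. \<forall>n. dist (y n) x \<le> (norm v + norm w) * (1 / real (Suc n)) \<and>
        Q v w (1 / real (Suc n)) = iter_frechet u [w, v] (y n)"
      by (intro choice allI)
    then obtain y where y: "\<And>n. dist (y n) x \<le> (norm v + norm w) * (1 / real (Suc n))"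
      and Q: "\<And>n. Q v w (1 / real (Suc n)) = iter_frechet u [w, v] (y n)"
      by blast
    have "(\<lambda>n. (norm v + norm w) * (1 / real (Suc n))) \<longlonglongrightarrow> (norm v + norm w) * 0"
      by (rule tendsto_mult_left [OF LIMSEQ_Suc [OF lim_1_over_n]])
    then have "(\<lambda>n. (norm v + norm w) * (1 / real (Suc n))) \<longlonglongrightarrow> 0"
      by (simp only: mult_zero_right)
    then have "(\<lambda>n. dist (y n) x) \<longlonglongrightarrow> 0"
      by (rule Lim_null_comparison [rotated]) (simp only: real_norm_def abs_of_nonneg zero_le_dist y eventually_True)
    then have "y \<longlonglongrightarrow> x" by (rule iffD2 [OF tendsto_dist_iff])
    \<comment> \<open>The second derivative is continuous because it is itself
      differentiable.\<close>
    moreover have "isCont (iter_frechet u [w, v]) x"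
      using u unfolding smooth_def by (intro differentiable_imp_continuous_within) blast
    ultimately show ?thesis
      unfolding Q by (intro isCont_tendsto_compose [where g = "iter_frechet u [w, v]"])
  qed
  have "Q w v = Q v w"
    unfolding Q_def by (intro ext arg_cong2 [where f = "(/)"] refl) (simp add: add.commute add.left_commute)
  from LIMSEQ_unique [OF lim [of w v, unfolded this] lim [of v w]]
  show "iter_frechet u [v, w] x = iter_frechet u [w, v] x" .
qed

text \<open>Adjacent swaps carry the outermost direction \<open>v\<close> to the innermost
  place.\<close>

lemma iter_frechet_Cons_eq:
  fixes u :: "'a::euclidean_space \<Rightarrow> real"
  assumes "smooth u"
  shows "iter_frechet u (v # vs) = iter_frechet (iter_frechet u [v]) vs"
proof (induction vs)
  case (Cons w ws)
  have "iter_frechet u (v # w # ws) = iter_frechet (iter_frechet u ws) [w, v]"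
    using iter_frechet_swap [OF smooth_iter_frechet [OF assms], of ws v w]
      iter_frechet_append [of u "[v, w]" ws] by simp
  also have "\<dots> = iter_frechet (iter_frechet u (v # ws)) [w]"
    using iter_frechet_append [of u "[w, v]" ws] iter_frechet_Cons [of u w "v # ws"] by simp
  also have "\<dots> = iter_frechet (iter_frechet u [v]) (w # ws)"
    unfolding Cons.IH by (rule iter_frechet_Cons [symmetric])
  finally show ?case .
qed simp

text \<open>\<open>mi_list\<close> fixes an arbitrary order of the partial derivatives, whereas the
  recursions produce lists in any order; this lemma reconciles the two.\<close>

lemma iter_frechet_mset_cong:
  fixes u :: "'a::euclidean_space \<Rightarrow> real"
  assumes "smooth u" "mset vs = mset ws"
  shows "iter_frechet u vs = iter_frechet u ws"
  using assms(2)
proof (induction vs arbitrary: ws)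
  case (Cons v vs)
  then obtain as bs where ws: "ws = as @ v # bs"
    by (metis list.set_intros(1) mset_eq_setD split_list)
  then have "mset vs = mset (as @ bs)" using Cons.prems by simp
  from Cons.IH [OF this] have "iter_frechet u (v # vs) = iter_frechet (iter_frechet u bs) (v # as)"
    unfolding iter_frechet_append by (simp only: iter_frechet.simps(2))
  then show ?case
    unfolding ws iter_frechet_append
    by (simp only: iter_frechet_Cons_eq [OF smooth_iter_frechet [OF assms(1)], of bs v as] iter_frechet_append
        iter_frechet_Cons [of u v bs])
qed simp

text \<open>Linearity is evident only in the outermost direction, where it is that of a Frechet
  derivative. Symmetry transports it to the innermost one, which is the one that inductions split
  off.\<close>

lemma iter_frechet_linear:
  fixes u :: "'a::euclidean_space \<Rightarrow> real"
  assumes "smooth u"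
  shows "iter_frechet u (vs @ [v]) x = (\<Sum>b\<in>Basis. (v \<bullet> b) * iter_frechet (iter_frechet u [b]) vs x)"
proof -
  have lin: "linear (\<lambda>v. iter_frechet (iter_frechet u vs) [v] x)"
    using smooth_imp_has_derivative [OF smooth_iter_frechet [OF assms]] has_derivative_linear by blast
  have "iter_frechet u (vs @ [v]) x = iter_frechet (iter_frechet u vs) [v] x"
    unfolding iter_frechet_append iter_frechet_Cons_eq [OF assms, of v vs, symmetric]
    by (subst iter_frechet_Cons) (rule refl)
  also have "\<dots> = (\<Sum>b\<in>Basis. (v \<bullet> b) * iter_frechet (iter_frechet u vs) [b] x)"
    using linear_sum [OF lin, of "\<lambda>b. (v \<bullet> b) *\<^sub>R b" Basis]
    by (simp add: euclidean_representation linear_cmul [OF lin])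
  also have "\<dots> = (\<Sum>b\<in>Basis. (v \<bullet> b) * iter_frechet (iter_frechet u [b]) vs x)"
    unfolding iter_frechet_Cons [symmetric] iter_frechet_Cons_eq [OF assms, of _ vs] ..
  finally show ?thesis .
qed

text \<open>Expanding the innermost direction in the basis, with coefficients at most 1 in absolute
  value, reduces to the finitely many functions \<open>iter_frechet u [b]\<close> and one direction
  less.\<close>

lemma iter_frechet_unit_bounded:
  fixes u :: "'a::euclidean_space \<Rightarrow> real"
  assumes "smooth u"
  shows "\<exists>C. \<forall>vs. length vs = k \<and> (\<forall>v\<in>set vs. norm v \<le> 1) \<longrightarrow> \<bar>iter_frechet u vs x\<bar> \<le> C"
  using assms
proof (induction k arbitrary: u)
  case (Suc k)
  have "\<exists>C. \<forall>b vs. length vs = k \<and> (\<forall>v\<in>set vs. norm v \<le> 1) \<longrightarrow>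
      \<bar>iter_frechet (iter_frechet u [b]) vs x\<bar> \<le> C b"
    by (intro choice allI Suc.IH smooth_iter_frechet Suc.prems)
  then obtain C where C: "\<And>b vs. length vs = k \<Longrightarrow> (\<forall>v\<in>set vs. norm v \<le> 1) \<Longrightarrow>
      \<bar>iter_frechet (iter_frechet u [b]) vs x\<bar> \<le> C b"
    by blast
  show ?case
  proof (intro exI [of _ "\<Sum>b\<in>Basis. C b"] allI impI)
    fix vs :: "'a list" assume vs: "length vs = Suc k \<and> (\<forall>v\<in>set vs. norm v \<le> 1)"
    then obtain ws v where ws: "vs = ws @ [v]" by (metis length_Suc_conv_rev)
    have "\<bar>(v \<bullet> b) * iter_frechet (iter_frechet u [b]) ws x\<bar> \<le> 1 * C b" if "b \<in> Basis" for b
      unfolding abs_mult using vs ws Basis_le_norm [OF that, of v]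
      by (intro mult_mono C) auto
    then show "\<bar>iter_frechet u vs x\<bar> \<le> (\<Sum>b\<in>Basis. C b)"
      unfolding ws iter_frechet_linear [OF Suc.prems]
      by (intro order_trans [OF sum_abs] sum_mono) auto
  qed
qed auto

text \<open>A supremum of reals bounds its elements only when the set is bounded above; that
  boundedness, obtained coordinate by coordinate, is the content.\<close>

lemma iter_frechet_le_frechet_norm:
  fixes f :: "'a::euclidean_space \<Rightarrow> 'b::euclidean_space"
  assumes f: "smooth f" and vs: "\<forall>v\<in>set vs. norm v \<le> 1"
  shows "norm (iter_frechet f vs x) \<le> frechet_norm (length vs) f x"
  unfolding frechet_norm_def
proof (rule cSUP_upper)
  let ?S = "{ws. length ws = length vs \<and> (\<forall>v\<in>set ws. norm v \<le> 1)}"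
  show "vs \<in> ?S" using vs by simp
  have "\<exists>C. \<forall>ws\<in>?S. \<bar>iter_frechet f ws x \<bullet> b\<bar> \<le> C" for b
    using iter_frechet_unit_bounded [OF smooth_bounded_linear [OF f bounded_linear_inner_left, of b]]
    unfolding iter_frechet_bounded_linear [OF f bounded_linear_inner_left] by auto
  then have "\<exists>C. \<forall>b. \<forall>ws\<in>?S. \<bar>iter_frechet f ws x \<bullet> b\<bar> \<le> C b"
    by (intro choice) blast
  then obtain C where C: "\<And>b ws. ws \<in> ?S \<Longrightarrow> \<bar>iter_frechet f ws x \<bullet> b\<bar> \<le> C b"
    by blast
  show "bdd_above ((\<lambda>vs. norm (iter_frechet f vs x)) ` ?S)"
  proof (rule bdd_aboveI2)
    show "norm (iter_frechet f ws x) \<le> (\<Sum>b\<in>Basis. C b)" if "ws \<in> ?S" for ws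
      by (rule order_trans [OF norm_le_l1 sum_mono [OF C [OF that]]])
  qed
qed

section \<open>A Sobolev inequality\<close>

text \<open>The fundamental theorem of calculus for (1 - s) u(y + s b), which equals u(y) at s = 0
  and vanishes at s = 1; the weight 1 - s lies between 0 and 1.\<close>

lemma abs_le_nn_integral_segment:
  fixes u :: "'a::euclidean_space \<Rightarrow> real"
  assumes u: "smooth u"
  shows "ennreal \<bar>u y\<bar> \<le> (\<integral>\<^sup>+s. ennreal (\<bar>u (y + s *\<^sub>R b)\<bar> + \<bar>iter_frechet u [b] (y + s *\<^sub>R b)\<bar>) * indicator {0..1} s \<partial>lborel)"
proof -
  define F' where "F' = (\<lambda>s. (1 - s) * iter_frechet u [b] (y + s *\<^sub>R b) - u (y + s *\<^sub>R b))"
  define G where "G = (\<lambda>s. \<bar>u (y + s *\<^sub>R b)\<bar> + \<bar>iter_frechet u [b] (y + s *\<^sub>R b)\<bar>)"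
  have "((\<lambda>s. (1 - s) * u (y + s *\<^sub>R b)) has_real_derivative F' s) (at s)" for s
    unfolding F'_def
    by (rule derivative_eq_intros has_real_derivative_along_line [OF u] refl)+ (simp add: algebra_simps)
  then have F': "(F' has_integral ((1 - 1) * u (y + 1 *\<^sub>R b) - (1 - 0) * u (y + 0 *\<^sub>R b))) {0..1}"
    by (intro fundamental_theorem_of_calculus)
       (auto simp: has_real_derivative_iff_has_vector_derivative [symmetric] intro: has_field_derivative_at_within)
  have "continuous_on {0..1} G"
    unfolding G_def
    by (intro continuous_intros continuous_on_compose2 [OF smooth_imp_continuous [OF u, of UNIV]]
        continuous_on_compose2 [OF smooth_imp_continuous [OF smooth_iter_frechet [OF u], of UNIV]] subset_UNIV)
  then have G: "(G has_integral integral {0..1} G) {0..1}"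
    by (simp add: integrable_continuous_real integrable_integral)
  have "norm (F' s) \<le> G s" if "s \<in> {0..1}" for s
  proof -
    have "\<bar>(1 - s) * iter_frechet u [b] (y + s *\<^sub>R b)\<bar> \<le> 1 * \<bar>iter_frechet u [b] (y + s *\<^sub>R b)\<bar>"
      unfolding abs_mult using that by (intro mult_right_mono) auto
    then show ?thesis unfolding F'_def G_def by simp
  qed
  then have "norm (integral {0..1} F') \<le> integral {0..1} G"
    using F' G by (intro integral_norm_bound_integral) (auto simp: has_integral_integrable)
  then have "\<bar>u y\<bar> \<le> integral {0..1} G"
    using F' by (simp add: integral_unique)
  also have "ennreal (integral {0..1} G) = (\<integral>\<^sup>+s. ennreal (G s) * indicator {0..1} s \<partial>lborel)"
    by (rule nn_integral_has_integral_lebesgue' [symmetric]) (use G in \<open>auto simp: G_def\<close>)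
  finally show ?thesis by (simp add: G_def ennreal_leI)
qed

text \<open>One coordinate direction is integrated. Each list \<open>vs\<close> gives rise to
  \<open>vs\<close> and \<open>b # vs\<close>, which is how \<open>subseqs (b # bs)\<close> arises
  from \<open>subseqs bs\<close>.\<close>

lemma sum_list_abs_le_nn_integral_segment:
  fixes u :: "'a::euclidean_space \<Rightarrow> real"
  assumes u: "smooth u"
  shows "ennreal (\<Sum>vs\<leftarrow>vss. \<bar>iter_frechet u vs y\<bar>) \<le>
    (\<integral>\<^sup>+s. ennreal (\<Sum>vs\<leftarrow>vss. \<bar>iter_frechet u vs (y + s *\<^sub>R b)\<bar> + \<bar>iter_frechet u (b # vs) (y + s *\<^sub>R b)\<bar>)
       * indicator {0..1} s \<partial>lborel)"
proof (induction vss)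
  case (Cons vs vss)
  define f where "f = (\<lambda>vs s. \<bar>iter_frechet u vs (y + s *\<^sub>R b)\<bar> + \<bar>iter_frechet u (b # vs) (y + s *\<^sub>R b)\<bar>)"
  have f [measurable]: "f vs \<in> borel_measurable borel" for vs
    unfolding f_def
    by (intro borel_measurable_add borel_measurable_abs measurable_compose [OF _ smooth_imp_borel [OF smooth_iter_frechet [OF u]]])
       simp_all
  have fs [measurable]: "(\<lambda>s. \<Sum>vs\<leftarrow>vss. f vs s) \<in> borel_measurable borel"
    by (induction vss) simp_all
  have f0: "0 \<le> f vs s" "0 \<le> (\<Sum>vs\<leftarrow>vss. f vs s)" for vs s
    by (auto simp: f_def intro!: sum_list_nonneg)
  have "ennreal \<bar>iter_frechet u vs y\<bar> \<le> (\<integral>\<^sup>+s. ennreal (f vs s) * indicator {0..1} s \<partial>lborel)"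
    using abs_le_nn_integral_segment [OF smooth_iter_frechet [OF u], of vs y b]
    by (simp add: f_def iter_frechet_Cons [of u b vs])
  then have "ennreal \<bar>iter_frechet u vs y\<bar> + ennreal (\<Sum>vs\<leftarrow>vss. \<bar>iter_frechet u vs y\<bar>) \<le>
     (\<integral>\<^sup>+s. ennreal (f vs s) * indicator {0..1} s \<partial>lborel) +
     (\<integral>\<^sup>+s. ennreal (\<Sum>vs\<leftarrow>vss. f vs s) * indicator {0..1} s \<partial>lborel)"
    using Cons.IH unfolding f_def by (rule add_mono)
  also have "\<dots> = (\<integral>\<^sup>+s. ennreal (f vs s) * indicator {0..1} s + ennreal (\<Sum>vs\<leftarrow>vss. f vs s) * indicator {0..1} s \<partial>lborel)"
    by (intro nn_integral_add [symmetric]) measurable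
  also have "\<dots> = (\<integral>\<^sup>+s. ennreal (\<Sum>vs\<leftarrow>vs # vss. f vs s) * indicator {0..1} s \<partial>lborel)"
    by (intro nn_integral_cong)
       (simp add: distrib_right [symmetric] f0 ennreal_plus [symmetric] del: ennreal_plus)
  moreover have "0 \<le> (\<Sum>vs\<leftarrow>vss. \<bar>iter_frechet u vs y\<bar>)"
    by (intro sum_list_nonneg) auto
  ultimately show ?case
    by (simp add: f_def)
qed simp

text \<open>The mixed derivatives that occur have order at most one in each direction, so they are
  indexed by the subsequences of \<open>bs\<close>. The product measure over \<open>set bs\<close>
  makes adding a direction a single application of Tonelli's theorem.\<close>

lemma abs_le_nn_integral_cube_PiM:
  fixes u :: "'a::euclidean_space \<Rightarrow> real"
  assumes u: "smooth u" and "distinct bs"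
  shows "ennreal \<bar>u x\<bar> \<le> (\<integral>\<^sup>+t. ennreal (\<Sum>vs\<leftarrow>subseqs bs. \<bar>iter_frechet u vs (x + (\<Sum>b\<in>set bs. t b *\<^sub>R b))\<bar>)
      * (\<Prod>b\<in>set bs. indicator {0..1} (t b)) \<partial>(\<Pi>\<^sub>M b\<in>set bs. lborel))"
  using assms(2)
proof (induction bs)
  case Nil
  then show ?case by (simp add: PiM_empty nn_integral_count_space_finite)
next
  case (Cons b bs)
  interpret product_sigma_finite "\<lambda>_. lborel :: real measure" ..
  define f where "f = (\<lambda>vss y. \<Sum>vs\<leftarrow>vss. \<bar>iter_frechet u vs y\<bar>)"
  have f [measurable]: "f vss \<in> borel_measurable borel" for vss
    unfolding f_def
    by (induction vss) (use smooth_imp_borel [OF smooth_iter_frechet [OF u]] in simp_all)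
  let ?\<Sigma> = "\<lambda>bs t. x + (\<Sum>b\<in>set bs. t b *\<^sub>R b)"
  have \<Sigma> [measurable]: "?\<Sigma> bs \<in> borel_measurable (\<Pi>\<^sub>M b\<in>set bs. lborel)" for bs
    by (intro borel_measurable_add borel_measurable_const borel_measurable_sum borel_measurable_scaleR) auto
  have ind [measurable]: "(\<lambda>t. \<Prod>b\<in>set bs. indicator {0..1} (t b :: real) :: ennreal) \<in> borel_measurable (\<Pi>\<^sub>M b\<in>set bs. lborel)" for bs
    by (intro borel_measurable_prod_ennreal measurable_compose [OF measurable_component_singleton] borel_measurable_indicator) auto
  have \<Sigma>_upd: "?\<Sigma> (b # bs) (t(b := s)) = ?\<Sigma> bs t + s *\<^sub>R b" for t s
  proof -
    have "(\<Sum>c\<in>set bs. (t(b := s)) c *\<^sub>R c) = (\<Sum>c\<in>set bs. t c *\<^sub>R c)"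
      using Cons.prems by (intro sum.cong) auto
    then show ?thesis using Cons.prems by (simp add: algebra_simps)
  qed
  have ind_upd: "(\<Prod>c\<in>set (b # bs). indicator {0..1} ((t(b := s)) c)) = (\<Prod>c\<in>set bs. indicator {0..1} (t c)) * (indicator {0..1} s :: ennreal)" for t s
  proof -
    have "(\<Prod>c\<in>set bs. indicator {0..1} ((t(b := s)) c)) = (\<Prod>c\<in>set bs. indicator {0..1} (t c) :: ennreal)"
      using Cons.prems by (intro prod.cong) auto
    then show ?thesis using Cons.prems by (simp add: mult.commute)
  qed
  have step: "ennreal (f (subseqs bs) y) \<le> (\<integral>\<^sup>+s. ennreal (f (subseqs (b # bs)) (y + s *\<^sub>R b)) * indicator {0..1} s \<partial>lborel)" for y
    using sum_list_abs_le_nn_integral_segment [OF u, of y "subseqs bs" b]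
    by (simp add: f_def Let_def comp_def sum_list_addf add.commute)
  have "ennreal \<bar>u x\<bar> \<le> (\<integral>\<^sup>+t. ennreal (f (subseqs bs) (?\<Sigma> bs t)) * (\<Prod>b\<in>set bs. indicator {0..1} (t b)) \<partial>(\<Pi>\<^sub>M b\<in>set bs. lborel))"
    using Cons by (simp add: f_def)
  also have "\<dots> \<le> (\<integral>\<^sup>+t. (\<integral>\<^sup>+s. ennreal (f (subseqs (b # bs)) (?\<Sigma> bs t + s *\<^sub>R b)) * indicator {0..1} s \<partial>lborel)
      * (\<Prod>b\<in>set bs. indicator {0..1} (t b)) \<partial>(\<Pi>\<^sub>M b\<in>set bs. lborel))"
    by (intro nn_integral_mono mult_right_mono step) simp
  \<comment> \<open>The inner variable \<open>s\<close> becomes the new coordinate of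
    \<open>t(b := s)\<close>, so that the two integrals merge into one over the larger
    product.\<close>
  also have "\<dots> = (\<integral>\<^sup>+t. (\<integral>\<^sup>+s. ennreal (f (subseqs (b # bs)) (?\<Sigma> (b # bs) (t(b := s))))
      * (\<Prod>c\<in>set (b # bs). indicator {0..1} ((t(b := s)) c)) \<partial>lborel) \<partial>(\<Pi>\<^sub>M b\<in>set bs. lborel))"
    unfolding \<Sigma>_upd ind_upd
    by (intro nn_integral_cong, subst nn_integral_multc [symmetric]) (auto simp: ac_simps)
  also have "\<dots> = (\<integral>\<^sup>+t. ennreal (f (subseqs (b # bs)) (?\<Sigma> (b # bs) t)) * (\<Prod>c\<in>set (b # bs). indicator {0..1} (t c))
      \<partial>(\<Pi>\<^sub>M b\<in>set (b # bs). lborel))"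
    unfolding list.set(2)
    using Cons.prems \<Sigma> [of "b # bs"] ind [of "b # bs"]
    by (intro product_nn_integral_insert [symmetric]) (auto simp del: sum.insert)
  finally show ?case unfolding f_def .
qed

lemma abs_le_nn_integral_cube:
  fixes u :: "'a::euclidean_space \<Rightarrow> real"
  assumes u: "smooth u" and bs: "distinct bs" "set bs = Basis"
  shows "ennreal \<bar>u x\<bar> \<le> (\<integral>\<^sup>+y. ennreal (\<Sum>vs\<leftarrow>subseqs bs. \<bar>iter_frechet u vs (x + y)\<bar>)
      * (\<Prod>b\<in>Basis. indicator {0..1} (y \<bullet> b)) \<partial>lborel)"
proof -
  define f where "f = (\<lambda>vss y. \<Sum>vs\<leftarrow>vss. \<bar>iter_frechet u vs y\<bar>)"
  have f [measurable]: "f vss \<in> borel_measurable borel" for vss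
    unfolding f_def
    by (induction vss) (use smooth_imp_borel [OF smooth_iter_frechet [OF u]] in simp_all)
  have "ennreal \<bar>u x\<bar> \<le> (\<integral>\<^sup>+t. ennreal (f (subseqs bs) (x + (\<Sum>b\<in>Basis. t b *\<^sub>R b)))
      * (\<Prod>b\<in>Basis. indicator {0..1} (t b)) \<partial>(\<Pi>\<^sub>M b\<in>Basis. lborel))"
    using abs_le_nn_integral_cube_PiM [OF u bs(1), of x] unfolding bs(2) f_def .
  \<comment> \<open>The coordinates are written as inner products, so that the integrand depends on
    \<open>t\<close> only through a point of the space and the image measure can be used.\<close>
  also have "\<dots> = (\<integral>\<^sup>+t. ennreal (f (subseqs bs) (x + (\<Sum>b\<in>Basis. t b *\<^sub>R b)))
      * (\<Prod>b\<in>Basis. indicator {0..1} ((\<Sum>c\<in>Basis. t c *\<^sub>R c) \<bullet> b)) \<partial>(\<Pi>\<^sub>M b\<in>Basis. lborel))"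
    by simp
  also have "\<dots> = (\<integral>\<^sup>+y. ennreal (f (subseqs bs) (x + y)) * (\<Prod>b\<in>Basis. indicator {0..1} (y \<bullet> b)) \<partial>lborel)"
    by (subst lborel_eq, subst nn_integral_distr) auto
  finally show ?thesis unfolding f_def .
qed

lemma nn_integral_lborel_translate:
  fixes h :: "'a::euclidean_space \<Rightarrow> ennreal"
  assumes "h \<in> borel_measurable borel"
  shows "(\<integral>\<^sup>+y. h (x + y) \<partial>lborel) = (\<integral>\<^sup>+y. h y \<partial>lborel)"
proof -
  have "(\<integral>\<^sup>+y. h y \<partial>lborel) = (\<integral>\<^sup>+y. h y \<partial>distr lborel borel ((+) x))"
    by (simp add: lborel_distr_plus)
  also have "\<dots> = (\<integral>\<^sup>+y. h (x + y) \<partial>lborel)"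
    using assms by (intro nn_integral_distr) auto
  finally show ?thesis by simp
qed

text \<open>For measurable \<open>u\<close> and nonnegative \<open>a\<close>, membership in L^p and
  a norm bound in one. The nonnegative integral also covers the infinite case, and the p-th powers
  keep roots out of the estimates.\<close>

definition Lp_le :: "real \<Rightarrow> ('a::euclidean_space \<Rightarrow> real) \<Rightarrow> real \<Rightarrow> bool" where
  "Lp_le p u a \<longleftrightarrow> (\<integral>\<^sup>+x. ennreal (\<bar>u x\<bar> powr p) \<partial>lborel) \<le> ennreal (a powr p)"

text \<open>Passes from integrals over a unit cube to L^p bounds over the whole space. Each
  derivative costs a factor 2, one unit for each term of the elementary inequality
  \<open>young\<close> below, which replaces Hoelder's inequality.\<close>

lemma abs_le_sum_Lp_bounds:
  fixes u :: "'a::euclidean_space \<Rightarrow> real"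
  assumes u: "smooth u" and bs: "distinct bs" "set bs = Basis" and p: "1 \<le> p"
    and A: "\<And>vs. vs \<in> set (subseqs bs) \<Longrightarrow> 0 < A vs"
    and Lp: "\<And>vs. vs \<in> set (subseqs bs) \<Longrightarrow> Lp_le p (iter_frechet u vs) (A vs)"
  shows "\<bar>u x\<bar> \<le> (\<Sum>vs\<leftarrow>subseqs bs. 2 * A vs)"
proof -
  define Q :: "'a \<Rightarrow> ennreal" where "Q = (\<lambda>y. \<Prod>b\<in>Basis. indicator {0..1} (y \<bullet> b))"
  have Q [measurable]: "Q \<in> borel_measurable borel" unfolding Q_def by measurable
  have Q1: "Q y \<le> 1" for y
    unfolding Q_def by (intro prod_le_1) (auto simp: indicator_def)
  have intQ: "(\<integral>\<^sup>+y. Q y \<partial>lborel) = 1"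
    unfolding Q_def by (subst nn_integral_lborel_prod) auto
  have D [measurable]: "iter_frechet u vs \<in> borel_measurable borel" for vs
    by (rule smooth_imp_borel [OF smooth_iter_frechet [OF u]])
  \<comment> \<open>Either z \<le> a, or z/a > 1 and then z/a \<le> (z/a)^p.\<close>
  have young: "z \<le> a + a * (z powr p / a powr p)" if "0 < a" "0 \<le> z" for z a :: real
  proof (cases "z \<le> a")
    case False
    have "(z / a) powr 1 \<le> (z / a) powr p"
      using False that p by (intro powr_mono) (auto simp: field_simps)
    then have "a * (z / a) \<le> a * (z powr p / a powr p)"
      using that by (intro mult_left_mono) (auto simp: powr_divide)
    then show ?thesis using that by simp
  qed (use that in \<open>auto intro: add_increasing2\<close>)
  have one: "(\<integral>\<^sup>+y. ennreal \<bar>iter_frechet u vs (x + y)\<bar> * Q y \<partial>lborel) \<le> ennreal (2 * A vs)"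
    if vs: "vs \<in> set (subseqs bs)" for vs
  proof -
    define a where "a = A vs"
    have a: "0 < a" using A [OF vs] by (simp add: a_def)
    have "ennreal \<bar>iter_frechet u vs (x + y)\<bar> * Q y \<le>
        ennreal a * Q y + ennreal (a / a powr p) * ennreal (\<bar>iter_frechet u vs (x + y)\<bar> powr p)" for y
    proof -
      define z where "z = \<bar>iter_frechet u vs (x + y)\<bar>"
      have "ennreal z \<le> ennreal (a + a * (z powr p / a powr p))"
        by (intro ennreal_leI young a) (simp add: z_def)
      also have "\<dots> = ennreal a + ennreal (a / a powr p) * ennreal (z powr p)"
        using a by (simp add: ennreal_mult [symmetric])
      finally have "ennreal z * Q y \<le> (ennreal a + ennreal (a / a powr p) * ennreal (z powr p)) * Q y"
        by (rule mult_right_mono) simp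
      also have "\<dots> = ennreal a * Q y + ennreal (a / a powr p) * ennreal (z powr p) * Q y"
        by (rule distrib_right)
      \<comment> \<open>The constant term keeps \<open>Q\<close>, whose integral is 1; in the other
        term \<open>Q\<close> is replaced by 1, so that the L^p bound over the whole space
        applies.\<close>
      also have "\<dots> \<le> ennreal a * Q y + ennreal (a / a powr p) * ennreal (z powr p) * 1"
        by (intro add_left_mono mult_left_mono Q1) simp
      finally show ?thesis by (simp add: z_def)
    qed
    then have "(\<integral>\<^sup>+y. ennreal \<bar>iter_frechet u vs (x + y)\<bar> * Q y \<partial>lborel) \<le>
        (\<integral>\<^sup>+y. ennreal a * Q y + ennreal (a / a powr p) * ennreal (\<bar>iter_frechet u vs (x + y)\<bar> powr p) \<partial>lborel)"
      by (intro nn_integral_mono)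
    also have "\<dots> = ennreal a * (\<integral>\<^sup>+y. Q y \<partial>lborel) +
        ennreal (a / a powr p) * (\<integral>\<^sup>+y. ennreal (\<bar>iter_frechet u vs (x + y)\<bar> powr p) \<partial>lborel)"
      by (subst nn_integral_add) (auto simp: nn_integral_cmult)
    also have "(\<integral>\<^sup>+y. ennreal (\<bar>iter_frechet u vs (x + y)\<bar> powr p) \<partial>lborel) = (\<integral>\<^sup>+y. ennreal (\<bar>iter_frechet u vs y\<bar> powr p) \<partial>lborel)"
      by (rule nn_integral_lborel_translate [where h = "\<lambda>y. ennreal (\<bar>iter_frechet u vs y\<bar> powr p)"]) measurable
    also have "ennreal a * (\<integral>\<^sup>+y. Q y \<partial>lborel) + ennreal (a / a powr p) * \<dots> \<le> ennreal a * 1 + ennreal (a / a powr p) * ennreal (a powr p)"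
      unfolding intQ a_def by (intro add_left_mono mult_left_mono Lp [unfolded Lp_le_def] vs) simp
    also have "\<dots> = ennreal (2 * a)"
      using a by (simp add: ennreal_mult [symmetric] ennreal_plus [symmetric] del: ennreal_plus)
    finally show ?thesis by (simp add: a_def)
  qed
  have "(\<integral>\<^sup>+y. ennreal (\<Sum>vs\<leftarrow>vss. \<bar>iter_frechet u vs (x + y)\<bar>) * Q y \<partial>lborel) \<le> ennreal (\<Sum>vs\<leftarrow>vss. 2 * A vs)"
    if "set vss \<subseteq> set (subseqs bs)" for vss
    using that
  proof (induction vss)
    case (Cons vs vss)
    have m [measurable]: "(\<lambda>y. \<Sum>vs\<leftarrow>vss. \<bar>iter_frechet u vs (x + y)\<bar>) \<in> borel_measurable borel"
      by (induction vss) simp_all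
    have m0: "0 \<le> (\<Sum>vs\<leftarrow>vss. \<bar>iter_frechet u vs (x + y)\<bar>)" for y
      by (intro sum_list_nonneg) auto
    have nn: "0 \<le> (\<Sum>vs\<leftarrow>vss. 2 * A vs)"
      using Cons.prems A by (intro sum_list_nonneg) (auto simp: subset_iff intro: less_imp_le)
    have "(\<integral>\<^sup>+y. ennreal (\<Sum>vs\<leftarrow>vs # vss. \<bar>iter_frechet u vs (x + y)\<bar>) * Q y \<partial>lborel) =
       (\<integral>\<^sup>+y. ennreal \<bar>iter_frechet u vs (x + y)\<bar> * Q y + ennreal (\<Sum>vs\<leftarrow>vss. \<bar>iter_frechet u vs (x + y)\<bar>) * Q y \<partial>lborel)"
      using m0 by (intro nn_integral_cong) (simp add: distrib_right [symmetric])
    also have "\<dots> = (\<integral>\<^sup>+y. ennreal \<bar>iter_frechet u vs (x + y)\<bar> * Q y \<partial>lborel) +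
        (\<integral>\<^sup>+y. ennreal (\<Sum>vs\<leftarrow>vss. \<bar>iter_frechet u vs (x + y)\<bar>) * Q y \<partial>lborel)"
      by (intro nn_integral_add) measurable
    also have "\<dots> \<le> ennreal (2 * A vs) + ennreal (\<Sum>vs\<leftarrow>vss. 2 * A vs)"
      using Cons by (intro add_mono one) auto
    also have "\<dots> = ennreal (\<Sum>vs\<leftarrow>vs # vss. 2 * A vs)"
      using nn Cons.prems A [of vs] by (simp add: ennreal_plus [symmetric] del: ennreal_plus)
    finally show ?case .
  qed simp
  from order_trans [OF abs_le_nn_integral_cube [OF u bs, of x] this [OF subset_refl, unfolded Q_def]]
  have "ennreal \<bar>u x\<bar> \<le> ennreal (\<Sum>vs\<leftarrow>subseqs bs. 2 * A vs)" .
  moreover have "0 \<le> (\<Sum>vs\<leftarrow>subseqs bs. 2 * A vs)"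
    using A by (intro sum_list_nonneg) (auto intro: less_imp_le)
  ultimately show ?thesis by (simp add: ennreal_le_iff)
qed

text \<open>There are 2^DIM subsequences of the basis, each contributing a factor 2. A subsequence
  of length e raises the order by e, and every summand is estimated by the full sum over e.\<close>

lemma sup_bound_of_Lp_bounds:
  fixes u :: "'a::euclidean_space \<Rightarrow> real"
  assumes u: "smooth u" and p: "1 \<le> p" and c: "\<And>k. 1 \<le> k \<Longrightarrow> 0 < c k"
    and Lp: "\<And>vs. set vs \<subseteq> Basis \<Longrightarrow> vs \<noteq> [] \<Longrightarrow> Lp_le p (iter_frechet u vs) (c (length vs))"
    and vs: "set vs \<subseteq> Basis" "vs \<noteq> []"
  shows "\<bar>iter_frechet u vs x\<bar> \<le> 2 ^ (DIM('a) + 1) * (\<Sum>e\<le>DIM('a). c (length vs + e))"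
proof -
  obtain bs :: "'a list" where bs: "set bs = Basis" "distinct bs"
    using finite_distinct_list [OF finite_Basis] by blast
  then have len: "length bs = DIM('a)" by (metis distinct_card)
  have pos: "0 < length vs" using vs by simp
  have length_subseq: "length ws \<le> length cs" if "ws \<in> set (subseqs cs)" for ws cs :: "'a list"
    using that by (induction cs arbitrary: ws) (auto simp: Let_def intro: le_SucI)
  have sub: "set ws \<subseteq> Basis \<and> length ws \<le> DIM('a)" if "ws \<in> set (subseqs bs)" for ws
  proof
    show "set ws \<subseteq> Basis" using that bs subseqs_powset [of bs] by auto
    show "length ws \<le> DIM('a)"
      using length_subseq [OF that] len by simp
  qed
  have c0: "0 \<le> c (length vs + e)" for e
    using c [of "length vs + e"] pos by simp
  define T where "T = (\<Sum>e\<le>DIM('a). c (length vs + e))"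
  have "\<bar>iter_frechet u vs x\<bar> \<le> (\<Sum>ws\<leftarrow>subseqs bs. 2 * c (length (ws @ vs)))"
  proof (rule abs_le_sum_Lp_bounds [OF smooth_iter_frechet [OF u] bs(2,1) p])
    fix ws assume ws: "ws \<in> set (subseqs bs)"
    show "0 < c (length (ws @ vs))" using pos by (intro c) (simp add: Suc_le_eq)
    show "Lp_le p (iter_frechet (iter_frechet u vs) ws) (c (length (ws @ vs)))"
      unfolding iter_frechet_append [symmetric] using sub [OF ws] vs by (intro Lp) auto
  qed
  also have "\<dots> \<le> (\<Sum>ws\<leftarrow>subseqs bs. 2 * T)"
  proof (rule sum_list_mono)
    fix ws assume "ws \<in> set (subseqs bs)"
    then have "c (length vs + length ws) \<le> T"
      using sub pos unfolding T_def
      by (intro member_le_sum [of _ _ "\<lambda>e. c (length vs + e)"]) (auto simp: c0)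
    then show "2 * c (length (ws @ vs)) \<le> 2 * T" by (simp add: add.commute)
  qed
  also have "\<dots> = 2 ^ (DIM('a) + 1) * T"
    by (simp add: sum_list_triv length_subseqs len)
  finally show ?thesis unfolding T_def .
qed

section \<open>Derivatives of a composition\<close>

lemma iter_frechet_add_list:
  assumes "smooth f" "smooth g"
  shows "iter_frechet (\<lambda>x. f x + g x) vs = (\<lambda>x. iter_frechet f vs x + iter_frechet g vs x)"
proof (induction vs)
  case (Cons v vs)
  have "iter_frechet (\<lambda>x. f x + g x) (v # vs) = iter_frechet (\<lambda>x. iter_frechet f vs x + iter_frechet g vs x) [v]"
    by (subst iter_frechet_Cons) (simp only: Cons.IH)
  also have "\<dots> = (\<lambda>x. iter_frechet f (v # vs) x + iter_frechet g (v # vs) x)"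
    using assms by (subst iter_frechet_add) (auto simp: smooth_def iter_frechet_Cons [of _ v vs])
  finally show ?case .
qed simp

text \<open>Pascal's rule, in the form in which the Leibniz rule passes from order n to n +
  1.\<close>

lemma binomial_sum_Suc:
  fixes a b :: "nat \<Rightarrow> real"
  shows "(\<Sum>r\<le>n. (n choose r) * a (Suc r) * b (n - r)) + (\<Sum>r\<le>n. (n choose r) * a r * b (Suc (n - r)))
    = (\<Sum>r\<le>Suc n. (Suc n choose r) * a r * b (Suc n - r))"
proof -
  define f where "f = (\<lambda>r. a r * b (Suc n - r))"
  have "(\<Sum>r\<le>n. (n choose r) * a r * b (Suc (n - r))) = (\<Sum>r\<le>n. (n choose r) * f r)"
    by (intro sum.cong) (auto simp: f_def Suc_diff_le)
  also have "\<dots> = (\<Sum>r\<le>Suc n. (n choose r) * f r)" by simp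
  also have "\<dots> = f 0 + (\<Sum>r\<le>n. (n choose Suc r) * f (Suc r))"
    by (subst sum.atMost_Suc_shift) simp
  finally have 1: "(\<Sum>r\<le>n. (n choose r) * a r * b (Suc (n - r))) = f 0 + (\<Sum>r\<le>n. (n choose Suc r) * f (Suc r))" .
  have "(\<Sum>r\<le>Suc n. (Suc n choose r) * f r) = f 0 + (\<Sum>r\<le>n. (Suc n choose Suc r) * f (Suc r))"
    by (subst sum.atMost_Suc_shift) simp
  also have "\<dots> = f 0 + (\<Sum>r\<le>n. (n choose r) * f (Suc r) + (n choose Suc r) * f (Suc r))"
    by (simp add: distrib_right)
  also have "\<dots> = (\<Sum>r\<le>n. (n choose r) * f (Suc r)) + (f 0 + (\<Sum>r\<le>n. (n choose Suc r) * f (Suc r)))"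
    by (simp add: sum.distrib)
  finally show ?thesis unfolding 1 by (simp add: f_def mult.assoc)
qed

text \<open>The Leibniz rule as a pointwise inequality. Since the bounds depend on the order alone,
  the sum over all ways to distribute the directions collapses to binomial coefficients. Splitting
  off the innermost direction shifts \<open>a\<close> in one term and \<open>b\<close> in the
  other.\<close>

lemma iter_frechet_mult_bound:
  fixes u v :: "'a::euclidean_space \<Rightarrow> real" and a b :: "nat \<Rightarrow> real"
  assumes "smooth u" "smooth v" "set vs \<subseteq> Basis"
    and "\<And>ws. set ws \<subseteq> Basis \<Longrightarrow> length ws \<le> length vs \<Longrightarrow> \<bar>iter_frechet u ws x\<bar> \<le> a (length ws)"
    and "\<And>ws. set ws \<subseteq> Basis \<Longrightarrow> length ws \<le> length vs \<Longrightarrow> \<bar>iter_frechet v ws x\<bar> \<le> b (length ws)"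
  shows "\<bar>iter_frechet (\<lambda>x. u x * v x) vs x\<bar> \<le>
    (\<Sum>r\<le>length vs. (length vs choose r) * a r * b (length vs - r))"
  using assms
proof (induction vs arbitrary: u v a b rule: rev_induct)
  case Nil
  have le: "\<bar>u x\<bar> \<le> a 0" "\<bar>v x\<bar> \<le> b 0"
    using Nil.prems(4,5) [of "[]"] by simp_all
  then have "0 \<le> a 0" by linarith
  with le have "\<bar>u x\<bar> * \<bar>v x\<bar> \<le> a 0 * b 0" by (intro mult_mono) auto
  then show ?case by (simp add: abs_mult)
next
  case (snoc w vs)
  have Basis: "w \<in> Basis" "set vs \<subseteq> Basis" using snoc.prems(3) by auto
  note smooth' = smooth_iter_frechet [OF snoc.prems(1)] smooth_iter_frechet [OF snoc.prems(2)]
  have "iter_frechet (\<lambda>x. u x * v x) (vs @ [w]) x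
      = iter_frechet (\<lambda>x. iter_frechet u [w] x * v x + u x * iter_frechet v [w] x) vs x"
    unfolding iter_frechet_append
    by (subst iter_frechet_mult) (auto intro: smooth_imp_differentiable snoc.prems)
  also have "\<dots> = iter_frechet (\<lambda>x. iter_frechet u [w] x * v x) vs x + iter_frechet (\<lambda>x. u x * iter_frechet v [w] x) vs x"
    by (subst iter_frechet_add_list) (auto intro: smooth_mult smooth' snoc.prems)
  finally have eq: "iter_frechet (\<lambda>x. u x * v x) (vs @ [w]) x = \<dots>" .
  have "\<bar>iter_frechet (\<lambda>x. iter_frechet u [w] x * v x) vs x\<bar> \<le>
      (\<Sum>r\<le>length vs. (length vs choose r) * a (Suc r) * b (length vs - r))"
  proof (rule snoc.IH [where a = "\<lambda>r. a (Suc r)"])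
    show "\<bar>iter_frechet (iter_frechet u [w]) ws x\<bar> \<le> a (Suc (length ws))"
      if "set ws \<subseteq> Basis" "length ws \<le> length vs" for ws
      using snoc.prems(4) [of "ws @ [w]"] that Basis by (simp add: iter_frechet_append)
  qed (use snoc.prems Basis smooth' in auto)
  moreover have "\<bar>iter_frechet (\<lambda>x. u x * iter_frechet v [w] x) vs x\<bar> \<le>
      (\<Sum>r\<le>length vs. (length vs choose r) * a r * b (Suc (length vs - r)))"
  proof (rule snoc.IH [where b = "\<lambda>r. b (Suc r)"])
    show "\<bar>iter_frechet (iter_frechet v [w]) ws x\<bar> \<le> b (Suc (length ws))"
      if "set ws \<subseteq> Basis" "length ws \<le> length vs" for ws
      using snoc.prems(5) [of "ws @ [w]"] that Basis by (simp add: iter_frechet_append)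
  qed (use snoc.prems Basis smooth' in auto)
  ultimately have "\<bar>iter_frechet (\<lambda>x. u x * v x) (vs @ [w]) x\<bar> \<le>
      (\<Sum>r\<le>Suc (length vs). (Suc (length vs) choose r) * a r * b (Suc (length vs) - r))"
    unfolding eq binomial_sum_Suc [of "length vs" a b, symmetric] by linarith
  then show ?case by simp
qed

text \<open>The innermost direction \<open>w\<close> is spent on the chain rule and the remaining
  ones on the Leibniz rule; the factor \<open>DIM('b)\<close> counts the coordinates of
  \<open>g\<close>. Here \<open>b r\<close> bounds derivatives of order r + 1, the direction
  \<open>w\<close> included.\<close>

lemma iter_frechet_compose_step:
  fixes H :: "'b::euclidean_space \<Rightarrow> real" and g :: "'a::euclidean_space \<Rightarrow> 'b" and a b :: "nat \<Rightarrow> real"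
  assumes H: "smooth H" and g: "\<And>j. j \<in> Basis \<Longrightarrow> smooth (\<lambda>x. g x \<bullet> j)"
    and vs: "set vs \<subseteq> Basis"
    and a: "\<And>j ws. j \<in> Basis \<Longrightarrow> set ws \<subseteq> Basis \<Longrightarrow> length ws \<le> length vs \<Longrightarrow>
      \<bar>iter_frechet (\<lambda>x. iter_frechet H [j] (g x)) ws x\<bar> \<le> a (length ws)"
    and b: "\<And>j ws. j \<in> Basis \<Longrightarrow> set ws \<subseteq> Basis \<Longrightarrow> length ws \<le> length vs \<Longrightarrow>
      \<bar>iter_frechet (\<lambda>x. g x \<bullet> j) (ws @ [w]) x\<bar> \<le> b (length ws)"
  shows "\<bar>iter_frechet (\<lambda>x. H (g x)) (vs @ [w]) x\<bar> \<le>
    DIM('b) * (\<Sum>r\<le>length vs. (length vs choose r) * a r * b (length vs - r))"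
proof -
  have sm: "smooth (\<lambda>x. iter_frechet H [j] (g x))" for j
    by (rule smooth_compose [OF smooth_iter_frechet [OF H] g])
  define h where "h = (\<lambda>j x. iter_frechet H [j] (g x) * iter_frechet (\<lambda>x. g x \<bullet> j) [w] x)"
  define S where "S = (\<Sum>r\<le>length vs. (length vs choose r) * a r * b (length vs - r))"
  have h: "smooth (h j)" if "j \<in> Basis" for j
    unfolding h_def by (rule smooth_mult [OF sm smooth_iter_frechet [OF g [OF that]]])
  have eq: "iter_frechet (\<lambda>x. H (g x)) [w] = (\<lambda>x. \<Sum>j\<in>Basis. h j x)"
    unfolding h_def by (rule iter_frechet_compose(1)) (fact H g)+
  have "iter_frechet (\<lambda>x. H (g x)) (vs @ [w]) x = (\<Sum>j\<in>Basis. iter_frechet (h j) vs x)"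
    unfolding iter_frechet_append eq by (subst iter_frechet_sum) (auto intro: h)
  then have "\<bar>iter_frechet (\<lambda>x. H (g x)) (vs @ [w]) x\<bar> \<le> (\<Sum>j\<in>Basis. \<bar>iter_frechet (h j) vs x\<bar>)"
    by (simp only: sum_abs)
  also have "\<dots> \<le> (\<Sum>j\<in>(Basis :: 'b set). S)"
  proof (rule sum_mono)
    fix j :: 'b assume j: "j \<in> Basis"
    show "\<bar>iter_frechet (h j) vs x\<bar> \<le> S"
      unfolding h_def S_def
    proof (rule iter_frechet_mult_bound [where a = a and b = b, OF sm smooth_iter_frechet [OF g [OF j]] vs])
      fix ws :: "'a list" assume h: "set ws \<subseteq> Basis" "length ws \<le> length vs"
      show "\<bar>iter_frechet (\<lambda>x. iter_frechet H [j] (g x)) ws x\<bar> \<le> a (length ws)"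
        by (rule a [OF j h])
      show "\<bar>iter_frechet (iter_frechet (\<lambda>x. g x \<bullet> j) [w]) ws x\<bar> \<le> b (length ws)"
        using b [OF j h] by (simp only: iter_frechet_append)
    qed
  qed
  also have "\<dots> = DIM('b) * S" by simp
  finally show ?thesis unfolding S_def .
qed

text \<open>Each step trades a derivative in x for a further derivative of \<open>F\<close>, so the
  induction on the order must vary \<open>js\<close>. Any solution \<open>X\<close> of the recursive
  inequality will do, which lets the classes with and without weights share the argument.
  \<open>js\<close> is nonempty because \<open>F\<close> itself has no bound.\<close>

lemma iter_frechet_compose_bound:
  fixes F :: "'b::euclidean_space \<Rightarrow> real" and g :: "'a::euclidean_space \<Rightarrow> 'b"
    and X :: "nat \<Rightarrow> nat \<Rightarrow> real" and B :: "nat \<Rightarrow> real"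
  assumes F: "smooth F" and g: "\<And>j. j \<in> Basis \<Longrightarrow> smooth (\<lambda>x. g x \<bullet> j)"
    and A: "\<And>js. set js \<subseteq> Basis \<Longrightarrow> js \<noteq> [] \<Longrightarrow> \<bar>iter_frechet F js (g x)\<bar> \<le> X (length js) 0"
    and B: "\<And>j vs. j \<in> Basis \<Longrightarrow> set vs \<subseteq> Basis \<Longrightarrow> vs \<noteq> [] \<Longrightarrow>
      \<bar>iter_frechet (\<lambda>x. g x \<bullet> j) vs x\<bar> \<le> B (length vs)"
    and X: "\<And>s k. DIM('b) * (\<Sum>r\<le>k. (k choose r) * X (Suc s) r * B (Suc (k - r))) \<le> X s (Suc k)"
    and js: "set js \<subseteq> Basis" "js \<noteq> []" and vs: "set vs \<subseteq> Basis"
  shows "\<bar>iter_frechet (\<lambda>x. iter_frechet F js (g x)) vs x\<bar> \<le> X (length js) (length vs)"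
  using js vs
proof (induction "length vs" arbitrary: js vs rule: less_induct)
  case less
  show ?case
  proof (cases vs rule: rev_cases)
    case Nil
    then show ?thesis using A less.prems by simp
  next
    case (snoc us w)
    have "\<bar>iter_frechet (\<lambda>x. iter_frechet F js (g x)) (us @ [w]) x\<bar> \<le>
       DIM('b) * (\<Sum>r\<le>length us. (length us choose r) * X (Suc (length js)) r * B (Suc (length us - r)))"
    proof (rule iter_frechet_compose_step [where a = "\<lambda>r. X (Suc (length js)) r" and b = "\<lambda>r. B (Suc r)",
        OF smooth_iter_frechet [OF F] g])
      fix j :: 'b and ws :: "'a list" assume h: "j \<in> Basis" "set ws \<subseteq> Basis" "length ws \<le> length us"
      show "\<bar>iter_frechet (\<lambda>x. iter_frechet (iter_frechet F js) [j] (g x)) ws x\<bar> \<le> X (Suc (length js)) (length ws)"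
        unfolding iter_frechet_Cons [symmetric]
        using less.hyps [of ws "j # js"] less.prems h snoc by simp
      show "\<bar>iter_frechet (\<lambda>x. g x \<bullet> j) (ws @ [w]) x\<bar> \<le> B (Suc (length ws))"
        using B [of j "ws @ [w]"] h less.prems snoc by simp
    qed (use less.prems snoc in auto)
    also have "\<dots> \<le> X (length js) (Suc (length us))" by (rule X)
    finally show ?thesis using snoc by simp
  qed
qed

text \<open>One chain rule step brings in the first derivatives of \<open>F\<close>, to which the
  preceding bound applies. Only the derivative of \<open>g\<close> split off in this step is
  estimated with \<open>V\<close>, so \<open>V\<close> occurs exactly once and to the first
  power.\<close>

lemma iter_frechet_compose_weighted_bound:
  fixes F :: "'b::euclidean_space \<Rightarrow> real" and g :: "'a::euclidean_space \<Rightarrow> 'b"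
    and X :: "nat \<Rightarrow> nat \<Rightarrow> real" and B :: "nat \<Rightarrow> real"
  assumes F: "smooth F" and g: "\<And>j. j \<in> Basis \<Longrightarrow> smooth (\<lambda>x. g x \<bullet> j)"
    and A: "\<And>js. set js \<subseteq> Basis \<Longrightarrow> js \<noteq> [] \<Longrightarrow> \<bar>iter_frechet F js (g x)\<bar> \<le> X (length js) 0"
    and B: "\<And>j vs. j \<in> Basis \<Longrightarrow> set vs \<subseteq> Basis \<Longrightarrow> vs \<noteq> [] \<Longrightarrow>
      \<bar>iter_frechet (\<lambda>x. g x \<bullet> j) vs x\<bar> \<le> B (length vs)"
    and X: "\<And>s k. DIM('b) * (\<Sum>r\<le>k. (k choose r) * X (Suc s) r * B (Suc (k - r))) \<le> X s (Suc k)"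
    and V: "0 \<le> V" "\<And>j ws. j \<in> Basis \<Longrightarrow> set ws \<subseteq> Basis \<Longrightarrow> ws \<noteq> [] \<Longrightarrow> length ws \<le> length vs \<Longrightarrow>
      \<bar>iter_frechet (\<lambda>x. g x \<bullet> j) ws x\<bar> \<le> B (length ws) * V"
    and vs: "set vs \<subseteq> Basis" "vs \<noteq> []"
  shows "\<bar>iter_frechet (\<lambda>x. F (g x)) vs x\<bar> \<le> X 0 (length vs) * V"
proof -
  obtain us w where snoc: "vs = us @ [w]" using vs(2) by (cases vs rule: rev_cases) auto
  have "\<bar>iter_frechet (\<lambda>x. F (g x)) (us @ [w]) x\<bar> \<le>
     DIM('b) * (\<Sum>r\<le>length us. (length us choose r) * X (Suc 0) r * (B (Suc (length us - r)) * V))"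
  proof (rule iter_frechet_compose_step [where a = "\<lambda>r. X (Suc 0) r" and b = "\<lambda>r. B (Suc r) * V", OF F g])
    fix j :: 'b and ws :: "'a list" assume h: "j \<in> Basis" "set ws \<subseteq> Basis" "length ws \<le> length us"
    have "set [j] \<subseteq> Basis" "[j] \<noteq> []" using h(1) by auto
    note bound = iter_frechet_compose_bound [where F = F and g = g and X = X and B = B and x = x and js = "[j]" and vs = ws,
      OF F _ _ _ _ this h(2)]
    have "\<bar>iter_frechet (\<lambda>x. iter_frechet F [j] (g x)) ws x\<bar> \<le> X (length [j]) (length ws)"
      by (rule bound) (fact g A B X)+
    then show "\<bar>iter_frechet (\<lambda>x. iter_frechet F [j] (g x)) ws x\<bar> \<le> X (Suc 0) (length ws)"
      by simp
    show "\<bar>iter_frechet (\<lambda>x. g x \<bullet> j) (ws @ [w]) x\<bar> \<le> B (Suc (length ws)) * V"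
      using V(2) [of j "ws @ [w]"] h vs snoc by simp
  qed (use vs snoc in auto)
  also have "\<dots> = (DIM('b) * (\<Sum>r\<le>length us. (length us choose r) * X (Suc 0) r * B (Suc (length us - r)))) * V"
    by (simp add: sum_distrib_left sum_distrib_right mult.assoc)
  also have "\<dots> \<le> X 0 (Suc (length us)) * V" by (intro mult_right_mono X V)
  finally show ?thesis using snoc by simp
qed

text \<open>The left side counts the lists of length at most n over d letters. A bound geometric in
  n can later be absorbed into the radius.\<close>

lemma sum_power_le_Suc_power: "(\<Sum>i\<le>n. d ^ i) \<le> Suc d ^ n"
proof -
  have "(\<Sum>i\<le>n. d ^ i) \<le> (\<Sum>i\<le>n. (n choose i) * d ^ i)"
    by (intro sum_mono) (simp add: Suc_le_eq zero_less_binomial)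
  also have "\<dots> = Suc d ^ n"
    using binomial [of d 1 n] by simp
  finally show ?thesis .
qed

text \<open>A single function \<open>V\<close> in $L^p$ dominates all derivatives of \<open>g\<close> up to the given order, so that
  the pointwise composition estimate integrates without Minkowski's inequality.\<close>

lemma Lp_le_iter_frechet_compose:
  fixes F :: "'b::euclidean_space \<Rightarrow> real" and g :: "'a::euclidean_space \<Rightarrow> 'b"
    and X :: "nat \<Rightarrow> nat \<Rightarrow> real" and B :: "nat \<Rightarrow> real"
  assumes F: "smooth F" and g: "\<And>j. j \<in> Basis \<Longrightarrow> smooth (\<lambda>x. g x \<bullet> j)" and p: "1 \<le> p"
    and A: "\<And>js y. set js \<subseteq> Basis \<Longrightarrow> js \<noteq> [] \<Longrightarrow> \<bar>iter_frechet F js y\<bar> \<le> X (length js) 0"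
    and B: "\<And>j vs x. j \<in> Basis \<Longrightarrow> set vs \<subseteq> Basis \<Longrightarrow> vs \<noteq> [] \<Longrightarrow>
      \<bar>iter_frechet (\<lambda>x. g x \<bullet> j) vs x\<bar> \<le> B (length vs)"
    and B_pos: "\<And>k. 1 \<le> k \<Longrightarrow> 0 < B k"
    and Lp: "\<And>j vs. j \<in> Basis \<Longrightarrow> set vs \<subseteq> Basis \<Longrightarrow> vs \<noteq> [] \<Longrightarrow>
      Lp_le p (iter_frechet (\<lambda>x. g x \<bullet> j) vs) (B (length vs))"
    and X: "\<And>s k. DIM('b) * (\<Sum>r\<le>k. (k choose r) * X (Suc s) r * B (Suc (k - r))) \<le> X s (Suc k)"
    and X_nonneg: "\<And>s k. 0 \<le> X s k"
    and vs: "set vs \<subseteq> Basis" "vs \<noteq> []"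
  shows "Lp_le p (iter_frechet (\<lambda>x. F (g x)) vs) (X 0 (length vs) * (DIM('b) * Suc (DIM('a)) ^ length vs))"
proof -
  define S where "S = {ws :: 'a list. set ws \<subseteq> Basis \<and> length ws \<le> length vs}"
  define T where "T = (Basis :: 'b set) \<times> (S - {[]})"
  \<comment> \<open>\<open>V\<close> will be the p-th root of \<open>W\<close>. Each term of
    \<open>W\<close> is divided by the p-th power of its L^p bound and so has integral at most 1;
    the integral of \<open>W\<close> is then at most the number of terms.\<close>
  define W where "W = (\<lambda>x. \<Sum>(j, ws)\<in>T. \<bar>iter_frechet (\<lambda>x. g x \<bullet> j) ws x\<bar> powr p / B (length ws) powr p)"
  define N where "N = DIM('b) * Suc (DIM('a)) ^ length vs"
  have S: "finite S" "card S \<le> Suc (DIM('a)) ^ length vs"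
    unfolding S_def using finite_lists_length_le [of "Basis :: 'a set"] card_lists_length_le [of "Basis :: 'a set"]
      sum_power_le_Suc_power by (simp_all del: power_Suc)
  then have T: "finite T" "card T \<le> N"
    unfolding T_def N_def card_cartesian_product
    using card_mono [OF S(1), of "S - {[]}"] by (auto intro!: mult_le_mono2)
  have N: "1 \<le> real N"
  proof -
    have "0 < N" unfolding N_def by (intro mult_pos_pos zero_less_power) auto
    then show ?thesis by linarith
  qed
  have T_D: "j \<in> Basis" "set ws \<subseteq> Basis" "ws \<noteq> []" "0 < B (length ws)" if "(j, ws) \<in> T" for j ws
    using that B_pos by (auto simp: T_def S_def Suc_le_eq)
  have W_nonneg: "0 \<le> W x" for x unfolding W_def by (intro sum_nonneg) auto
  have D [measurable]: "iter_frechet (\<lambda>x. g x \<bullet> j) ws \<in> borel_measurable borel" if "j \<in> Basis" for j ws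
    by (intro smooth_imp_borel smooth_iter_frechet g that)
  have T_meas: "(\<lambda>x. \<bar>iter_frechet (\<lambda>x. g x \<bullet> fst t) (snd t) x\<bar> powr p) \<in> borel_measurable borel" if "t \<in> T" for t
  proof -
    have "fst t \<in> Basis" using that by (auto simp: T_def)
    from D [OF this, of "snd t"] show ?thesis by measurable
  qed
  have W_meas: "W \<in> borel_measurable borel"
    unfolding W_def case_prod_beta by (intro borel_measurable_sum borel_measurable_divide borel_measurable_const T_meas)
  have le: "\<bar>iter_frechet (\<lambda>x. F (g x)) vs x\<bar> \<le> X 0 (length vs) * W x powr (1 / p)" for x
  proof (rule iter_frechet_compose_weighted_bound [where F = F and g = g and X = X and B = B, OF F])
    fix j :: 'b and ws :: "'a list"
    assume h: "j \<in> Basis" "set ws \<subseteq> Basis" "ws \<noteq> []" "length ws \<le> length vs"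
    then have jws: "(j, ws) \<in> T" by (auto simp: T_def S_def)
    let ?D = "\<bar>iter_frechet (\<lambda>x. g x \<bullet> j) ws x\<bar>"
    note b = T_D(4) [OF jws]
    have "?D powr p / B (length ws) powr p \<le> W x"
      unfolding W_def using member_le_sum [OF jws, of "\<lambda>(j, ws). \<bar>iter_frechet (\<lambda>x. g x \<bullet> j) ws x\<bar> powr p / B (length ws) powr p"] T(1)
      by auto
    then have "(?D / B (length ws)) powr p \<le> W x" using b by (simp add: powr_divide)
    then have "((?D / B (length ws)) powr p) powr (1 / p) \<le> W x powr (1 / p)"
      using p by (intro powr_mono2) auto
    then have "?D / B (length ws) \<le> W x powr (1 / p)"
      using p b by (simp add: powr_powr)
    then show "?D \<le> B (length ws) * W x powr (1 / p)"
      using b by (simp add: field_simps)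
  qed (fact g A B X vs | simp)+
  have "\<bar>iter_frechet (\<lambda>x. F (g x)) vs x\<bar> powr p \<le> X 0 (length vs) powr p * W x" for x
  proof -
    have "\<bar>iter_frechet (\<lambda>x. F (g x)) vs x\<bar> powr p \<le> (X 0 (length vs) * W x powr (1 / p)) powr p"
      using p le by (intro powr_mono2) auto
    also have "\<dots> = X 0 (length vs) powr p * W x"
      using p X_nonneg W_nonneg by (simp add: powr_mult powr_powr)
    finally show ?thesis .
  qed
  then have "(\<integral>\<^sup>+x. ennreal (\<bar>iter_frechet (\<lambda>x. F (g x)) vs x\<bar> powr p) \<partial>lborel) \<le>
      (\<integral>\<^sup>+x. ennreal (X 0 (length vs) powr p) * ennreal (W x) \<partial>lborel)"
    by (intro nn_integral_mono) (simp add: ennreal_mult [symmetric] W_nonneg ennreal_leI)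
  also have "\<dots> = ennreal (X 0 (length vs) powr p) * (\<integral>\<^sup>+x. ennreal (W x) \<partial>lborel)"
    using W_meas by (intro nn_integral_cmult) simp
  also have "(\<integral>\<^sup>+x. ennreal (W x) \<partial>lborel) =
      (\<integral>\<^sup>+x. (\<Sum>t\<in>T. ennreal (1 / B (length (snd t)) powr p) * ennreal (\<bar>iter_frechet (\<lambda>x. g x \<bullet> fst t) (snd t) x\<bar> powr p)) \<partial>lborel)"
    unfolding W_def by (intro nn_integral_cong)
      (simp add: case_prod_beta ennreal_mult [symmetric] sum_ennreal)
  also have "\<dots> = (\<Sum>t\<in>T. ennreal (1 / B (length (snd t)) powr p) *
      (\<integral>\<^sup>+x. ennreal (\<bar>iter_frechet (\<lambda>x. g x \<bullet> fst t) (snd t) x\<bar> powr p) \<partial>lborel))"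
    using T_meas by (simp add: nn_integral_sum nn_integral_cmult)
  also have "\<dots> \<le> (\<Sum>t\<in>T. 1)"
  proof (rule sum_mono)
    fix t assume "t \<in> T"
    then obtain j ws where t: "t = (j, ws)" "(j, ws) \<in> T" by (cases t) auto
    note d = T_D [OF t(2)]
    have "ennreal (1 / B (length ws) powr p) * (\<integral>\<^sup>+x. ennreal (\<bar>iter_frechet (\<lambda>x. g x \<bullet> j) ws x\<bar> powr p) \<partial>lborel)
        \<le> ennreal (1 / B (length ws) powr p) * ennreal (B (length ws) powr p)"
      using Lp [OF d(1-3)] unfolding Lp_le_def by (rule mult_left_mono) simp
    also have "\<dots> = 1" using d(4) by (simp add: ennreal_mult [symmetric])
    finally show "ennreal (1 / B (length (snd t)) powr p) *
      (\<integral>\<^sup>+x. ennreal (\<bar>iter_frechet (\<lambda>x. g x \<bullet> fst t) (snd t) x\<bar> powr p) \<partial>lborel) \<le> 1"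
      by (simp add: t)
  qed
  also have "(\<Sum>t\<in>T. 1) \<le> ennreal (real N powr p)"
  proof -
    \<comment> \<open>Since N and p are at least 1, N is at most N^p, which makes the bound a p-th
      power.\<close>
    have "real (card T) \<le> real N powr 1" using T(2) N by simp
    also have "\<dots> \<le> real N powr p" using N p by (intro powr_mono) auto
    finally show ?thesis by (simp add: ennreal_of_nat_eq_real_of_nat ennreal_leI)
  qed
  finally have "(\<integral>\<^sup>+x. ennreal (\<bar>iter_frechet (\<lambda>x. F (g x)) vs x\<bar> powr p) \<partial>lborel) \<le>
      ennreal (X 0 (length vs) powr p) * ennreal (real N powr p)"
    by (simp add: mult_left_mono)
  also have "\<dots> = ennreal ((X 0 (length vs) * real N) powr p)"
    by (simp add: ennreal_mult [symmetric] powr_mult X_nonneg)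
  finally show ?thesis unfolding Lp_le_def N_def by simp
qed

section \<open>Weight sequences\<close>

lemma log_convex_ratio_mono:
  assumes M: "weight_sequence M" "log_convex M" and "i \<le> j"
  shows "M (Suc i) / M i \<le> M (Suc j) / M j"
proof -
  have pos: "0 < M k" for k using M(1) by (simp add: weight_sequence_def)
  have "M (Suc k) / M k \<le> M (Suc (Suc k)) / M (Suc k)" for k
    using M(2) [unfolded log_convex_def, rule_format, of "Suc k"] pos [of k] pos [of "Suc k"]
    by (simp add: field_simps power2_eq_square)
  from lift_Suc_mono_le [of "\<lambda>k. M (Suc k) / M k", OF this \<open>i \<le> j\<close>] show ?thesis .
qed

text \<open>Raising \<open>b\<close> by one multiplies the left side by
  \<open>M (Suc (Suc b)) / M (Suc b)\<close> and the right side by a quotient at a later index,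
  which is at least as large by log-convexity.\<close>

lemma log_convex_mult_le:
  assumes M: "weight_sequence M" "log_convex M"
  shows "M (Suc a) * M (Suc b) \<le> M 1 * M (Suc (a + b))"
proof (induction b)
  case (Suc b)
  have pos: "0 < M k" for k using M(1) by (simp add: weight_sequence_def)
  let ?r = "\<lambda>k. M (Suc k) / M k"
  have "M (Suc a) * M (Suc (Suc b)) = M (Suc a) * M (Suc b) * ?r (Suc b)"
    using pos [of "Suc b"] by simp
  also have "\<dots> \<le> M 1 * M (Suc (a + b)) * ?r (Suc b)"
    using Suc.IH pos by (intro mult_right_mono) (auto simp: less_imp_le)
  also have "\<dots> \<le> M 1 * M (Suc (a + b)) * ?r (Suc (a + b))"
    using pos by (intro mult_left_mono log_convex_ratio_mono [OF M]) (auto simp: less_imp_le)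
  also have "\<dots> = M 1 * M (Suc (a + Suc b))"
    using pos [of "Suc (a + b)"] by simp
  finally show ?case .
qed (simp add: mult.commute)

text \<open>Iterates M_(k+1) \<le> H^k M_k. The exponent is crude, but for fixed \<open>e\<close> it
  is linear in \<open>k\<close>, so the loss is geometric.\<close>

lemma derivation_closed_shift:
  assumes M: "weight_sequence M" and "derivation_closed M"
  obtains H where "1 \<le> H" "\<forall>k\<ge>1. \<forall>e. M (k + e) \<le> H ^ (e * (k + e)) * M k"
proof -
  have pos: "0 < M k" for k using M by (simp add: weight_sequence_def)
  obtain H0 where H0: "\<And>k. 1 \<le> k \<Longrightarrow> (M (k + 1) / M k) powr (1 / real k) \<le> H0"
    using assms(2) unfolding derivation_closed_def bdd_above_def by auto
  \<comment> \<open>At least 1, so that powers of \<open>H\<close> increase with the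
    exponent.\<close>
  define H where "H = max 1 H0"
  have H: "1 \<le> H" by (simp add: H_def)
  have one: "M (Suc k) \<le> H ^ k * M k" if "1 \<le> k" for k
  proof -
    have "((M (k + 1) / M k) powr (1 / real k)) powr real k \<le> H powr real k"
      using H0 [OF that] by (intro powr_mono2) (auto simp: H_def)
    then have "M (k + 1) / M k \<le> H ^ k"
      using that pos H by (simp add: powr_powr powr_realpow abs_of_pos)
    then show ?thesis using pos [of k] by (simp add: field_simps)
  qed
  show thesis
  proof
    have "M (k + e) \<le> H ^ (e * (k + e)) * M k" if "1 \<le> k" for k e
    proof (induction e)
      case (Suc e)
      have "M (k + Suc e) \<le> H ^ (k + e) * M (k + e)" using one [of "k + e"] that by simp
      also have "\<dots> \<le> H ^ (k + e) * (H ^ (e * (k + e)) * M k)"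
        using Suc.IH H by (intro mult_left_mono) auto
      also have "\<dots> = H ^ (Suc e * (k + e)) * M k" by (simp add: power_add)
      also have "\<dots> \<le> H ^ (Suc e * (k + Suc e)) * M k"
        using H pos [of k] by (intro mult_right_mono power_increasing) auto
      finally show ?case .
    qed simp
    then show "\<forall>k\<ge>1. \<forall>e. M (k + e) \<le> H ^ (e * (k + e)) * M k" by blast
  qed (rule H)
qed

text \<open>After division by c^k this is a partial sum of the series of (j + 1) c^(-j), whose value
  (1 - 1/c)^(-2) is at most 4 for c \<ge> 2.\<close>

lemma sum_linear_times_power_le:
  fixes c :: real
  assumes "2 \<le> c"
  shows "(\<Sum>r\<le>k. real (Suc (k - r)) * c ^ r) \<le> 4 * c ^ k"
proof (induction k)
  case (Suc k)
  have geo: "(\<Sum>r\<le>n. c ^ r) \<le> 2 * c ^ n" for n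
  proof (induction n)
    case (Suc n)
    have "2 * c ^ n \<le> c * c ^ n" using assms by (intro mult_right_mono) auto
    with Suc show ?case by simp
  qed simp
  have "(\<Sum>r\<le>Suc k. real (Suc (Suc k - r)) * c ^ r) = (\<Sum>r\<le>k. real (Suc (Suc k - r)) * c ^ r) + c ^ Suc k"
    by simp
  also have "(\<Sum>r\<le>k. real (Suc (Suc k - r)) * c ^ r) = (\<Sum>r\<le>k. real (Suc (k - r)) * c ^ r + c ^ r)"
    by (intro sum.cong) (auto simp: Suc_diff_le algebra_simps)
  also have "\<dots> + c ^ Suc k = (\<Sum>r\<le>k. real (Suc (k - r)) * c ^ r) + (\<Sum>r\<le>Suc k. c ^ r)"
    by (simp add: sum.distrib)
  also have "\<dots> \<le> 4 * c ^ k + 2 * c ^ Suc k" by (intro add_mono Suc.IH geo)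
  also have "\<dots> \<le> 4 * c ^ Suc k"
  proof -
    have "2 * c ^ k \<le> c * c ^ k" using assms by (intro mult_right_mono) auto
    then show ?thesis by simp
  qed
  finally show ?case .
qed simp

text \<open>\<open>X s k\<close> majorizes the derivatives of order \<open>k\<close> of (a derivative of order \<open>s\<close> of \<open>F\<close>) \<open>\<circ> g\<close>;
  its shape comes from the model case $F(y) = 1/(1-y)$, $g(t) = qt/(1-t)$.\<close>

lemma composition_majorant:
  fixes M B :: "nat \<Rightarrow> real" and X :: "nat \<Rightarrow> nat \<Rightarrow> real"
  assumes M: "weight_sequence M" "log_convex M"
    and pos: "0 < \<rho>" "0 < \<sigma>" "0 < C" "0 \<le> C'" and c: "c = 2 + 4 * (real d * \<rho> * C * M 1)"
  defines "X \<equiv> \<lambda>s k. C' * M (s + k) * \<rho> ^ s * (\<sigma> * c) ^ k * fact (s + k)"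
    and "B \<equiv> \<lambda>k. C * \<sigma> ^ k * fact k * M k"
  shows "real d * (\<Sum>r\<le>k. (k choose r) * X (Suc s) r * B (Suc (k - r))) \<le> X s (Suc k)"
proof -
  have Mpos: "0 < M k" for k using M(1) by (simp add: weight_sequence_def)
  have M0: "0 \<le> M k" for k using Mpos [of k] by simp
  \<comment> \<open>One use of the recursion produces the factor \<open>q\<close>, and the sum over
    r costs 4 c^k, which requires c \<ge> 2. Thus 4 q \<le> c closes the recursion, and c = 2 + 4 q
    satisfies both conditions.\<close>
  define q where "q = real d * \<rho> * C * M 1"
  have q: "0 \<le> q" unfolding q_def using pos Mpos [of 1] by simp
  have c2: "2 \<le> c" "4 * q \<le> c" using q by (simp_all add: c q_def)
  define K where "K = C' * C * \<rho> ^ Suc s * M 1 * M (Suc (s + k)) * \<sigma> ^ Suc k * fact (Suc (s + k))"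
  have K: "0 \<le> K" unfolding K_def using pos by (simp add: M0)
  have summand: "(k choose r) * X (Suc s) r * B (Suc (k - r)) \<le> K * (real (Suc (k - r)) * c ^ r)" if r: "r \<le> k" for r
  proof -
    have "M (Suc (s + r)) * M (Suc (k - r)) \<le> M 1 * M (Suc (s + k))"
      using log_convex_mult_le [OF M, of "s + r" "k - r"] r by simp
    \<comment> \<open>After cancelling k! and (s + 1)!, this is the monotonicity of the binomial
      coefficient (s + r + 1 choose s + 1) in r. The factor k - r + 1 comes from (k - r + 1)! and
      remains for the sum over r.\<close>
    moreover have "real (k choose r) * fact (Suc (s + r)) * fact (Suc (k - r)) \<le> real (Suc (k - r)) * fact (Suc (s + k))"
    proof -
      have "(Suc (s + r) choose Suc s) \<le> (Suc (s + k) choose Suc s)"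
        by (rule binomial_right_mono) (use r in simp)
      then have le: "real (Suc (s + r) choose Suc s) \<le> real (Suc (s + k) choose Suc s)"
        by (simp only: of_nat_le_iff)
      have eq: "fact (Suc (s + n)) = fact (Suc s) * fact n * real (Suc (s + n) choose Suc s)" for n
        using binomial_fact_lemma [of "Suc s" "Suc (s + n)"]
        by (metis (no_types, lifting) add_Suc add_diff_cancel_left' le_add1 of_nat_fact of_nat_mult)
      have "real (k choose r) * fact (Suc (s + r)) * fact (Suc (k - r))
          = real (Suc (k - r)) * ((fact r * fact (k - r) * real (k choose r)) * fact (Suc s) * real (Suc (s + r) choose Suc s))"
        unfolding eq [of r] fact_Suc [of "k - r"] by (simp only: of_nat_mult mult_ac)
      also have "fact r * fact (k - r) * real (k choose r) = fact k"
        using binomial_fact_lemma [OF r] by (metis of_nat_fact of_nat_mult)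
      also have "real (Suc (k - r)) * (fact k * fact (Suc s) * real (Suc (s + r) choose Suc s))
         \<le> real (Suc (k - r)) * (fact k * fact (Suc s) * real (Suc (s + k) choose Suc s))"
        by (intro mult_left_mono le) auto
      also have "\<dots> = real (Suc (k - r)) * fact (Suc (s + k))"
        unfolding eq [of k] by (simp only: mult_ac)
      finally show ?thesis .
    qed
    ultimately have "(M (Suc (s + r)) * M (Suc (k - r))) * (real (k choose r) * fact (Suc (s + r)) * fact (Suc (k - r)))
        \<le> (M 1 * M (Suc (s + k))) * (real (Suc (k - r)) * fact (Suc (s + k)))"
      by (rule mult_mono) (simp_all add: M0)
    then have "(C' * C * \<rho> ^ Suc s * \<sigma> ^ Suc k * c ^ r) *
          ((M (Suc (s + r)) * M (Suc (k - r))) * (real (k choose r) * fact (Suc (s + r)) * fact (Suc (k - r))))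
        \<le> (C' * C * \<rho> ^ Suc s * \<sigma> ^ Suc k * c ^ r) * ((M 1 * M (Suc (s + k))) * (real (Suc (k - r)) * fact (Suc (s + k))))"
      using pos c2 by (intro mult_left_mono) auto
    moreover have "\<sigma> ^ Suc k = \<sigma> ^ r * \<sigma> ^ Suc (k - r)"
      using r by (simp add: power_add [symmetric] del: power_Suc)
    ultimately show ?thesis
      unfolding X_def B_def K_def by (simp add: power_mult_distrib mult_ac del: fact_Suc power_Suc of_nat_Suc)
  qed
  have "real d * (\<Sum>r\<le>k. (k choose r) * X (Suc s) r * B (Suc (k - r))) \<le> real d * (K * (\<Sum>r\<le>k. real (Suc (k - r)) * c ^ r))"
    unfolding sum_distrib_left [of K] by (intro mult_left_mono sum_mono summand) auto
  also have "\<dots> \<le> real d * (K * (4 * c ^ k))"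
    by (intro mult_left_mono sum_linear_times_power_le c2 K) auto
  also have "\<dots> = (C' * \<rho> ^ s * M (Suc (s + k)) * \<sigma> ^ Suc k * fact (Suc (s + k)) * c ^ k) * (4 * q)"
    unfolding K_def q_def by (simp add: mult_ac)
  also have "\<dots> \<le> (C' * \<rho> ^ s * M (Suc (s + k)) * \<sigma> ^ Suc k * fact (Suc (s + k)) * c ^ k) * c"
    using pos c2 by (intro mult_left_mono) (simp_all add: M0)
  also have "\<dots> = X s (Suc k)"
    unfolding X_def by (simp add: power_mult_distrib mult_ac)
  finally show ?thesis .
qed

text \<open>The Sobolev loss is absorbed by (k + e)! \<le> 2^(k+e) k! e! and the shift bound for
  \<open>M\<close>. The new radius is a constant multiple of \<sigma>, as the Beurling case demands,
  and the constant in front does not depend on \<open>k\<close>.\<close>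

lemma weight_shift_sum_le:
  fixes M :: "nat \<Rightarrow> real"
  assumes H: "1 \<le> H" "\<forall>k\<ge>1. \<forall>e. M (k + e) \<le> H ^ (e * (k + e)) * M k"
    and M: "weight_sequence M" and pos: "0 < C" "0 < \<sigma>" and k: "1 \<le> k"
  shows "(\<Sum>e\<le>d. C * \<sigma> ^ (k + e) * fact (k + e) * M (k + e))
    \<le> (\<Sum>e\<le>d. C * \<sigma> ^ e * 2 ^ e * fact e * H ^ (d * d)) * (2 * H ^ d * \<sigma>) ^ k * fact k * M k"
proof -
  have Mpos: "0 < M k" for k using M by (simp add: weight_sequence_def)
  have le: "C * \<sigma> ^ (k + e) * fact (k + e) * M (k + e) \<le>
      C * \<sigma> ^ e * 2 ^ e * fact e * H ^ (d * d) * ((2 * H ^ d * \<sigma>) ^ k * fact k * M k)" if e: "e \<le> d" for e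
  proof -
    have "fact (k + e) = fact k * fact e * real (k + e choose k)"
      using binomial_fact_lemma [of k "k + e"]
      by (metis add_diff_cancel_left' le_add1 of_nat_fact of_nat_mult)
    also have "\<dots> \<le> fact k * fact e * 2 ^ (k + e)"
    proof -
      have "real (k + e choose k) \<le> real (2 ^ (k + e))"
        unfolding of_nat_le_iff by (rule binomial_le_pow2)
      then show ?thesis by (intro mult_left_mono) auto
    qed
    finally have f: "fact (k + e) \<le> fact k * fact e * (2 ^ (k + e) :: real)" .
    have "M (k + e) \<le> H ^ (e * (k + e)) * M k" using H(2) k by blast
    also have "\<dots> \<le> H ^ (d * (k + d)) * M k"
      using H(1) Mpos [of k] e by (intro mult_right_mono power_increasing mult_le_mono) auto
    finally have m: "M (k + e) \<le> H ^ (d * (k + d)) * M k" .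
    have "fact (k + e) * M (k + e) \<le> (fact k * fact e * 2 ^ (k + e)) * (H ^ (d * (k + d)) * M k)"
      using f m Mpos by (intro mult_mono) (auto simp: less_imp_le)
    then have "(C * \<sigma> ^ (k + e)) * (fact (k + e) * M (k + e)) \<le>
        (C * \<sigma> ^ (k + e)) * ((fact k * fact e * 2 ^ (k + e)) * (H ^ (d * (k + d)) * M k))"
      using pos by (intro mult_left_mono) auto
    also have "\<dots> = C * \<sigma> ^ e * 2 ^ e * fact e * H ^ (d * d) * ((2 * H ^ d * \<sigma>) ^ k * fact k * M k)"
      by (simp add: power_mult_distrib power_add distrib_left power_mult mult_ac)
    finally show ?thesis by (simp add: mult.assoc)
  qed
  have "(\<Sum>e\<le>d. C * \<sigma> ^ (k + e) * fact (k + e) * M (k + e)) \<le>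
      (\<Sum>e\<le>d. C * \<sigma> ^ e * 2 ^ e * fact e * H ^ (d * d) * ((2 * H ^ d * \<sigma>) ^ k * fact k * M k))"
    by (rule sum_mono, rule le) simp
  then show ?thesis
    by (simp only: sum_distrib_right [symmetric] mult.assoc [symmetric])
qed

section \<open>Passing between \<open>Lp_le\<close> and the L^p norm\<close>

lemma Lp_le_mono: "Lp_le p u a \<Longrightarrow> 0 \<le> a \<Longrightarrow> a \<le> b \<Longrightarrow> 0 \<le> p \<Longrightarrow> Lp_le p u b"
  unfolding Lp_le_def by (erule order_trans) (intro ennreal_leI powr_mono2)

lemma Lp_le_Lp_norm:
  assumes "Lp_finite p u" "1 \<le> p"
  shows "Lp_le p u (Lp_norm p u)"
proof -
  have "0 \<le> (LINT x|lborel. \<bar>u x\<bar> powr p)" by simp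
  then show ?thesis
    using assms unfolding Lp_le_def Lp_norm_def Lp_finite_def
    by (simp add: nn_integral_eq_integral powr_powr)
qed

lemma Lp_finite_of_Lp_le:
  assumes "u \<in> borel_measurable borel" "Lp_le p u a"
  shows "Lp_finite p u"
proof -
  have [measurable]: "(\<lambda>x. \<bar>u x\<bar> powr p) \<in> borel_measurable borel" using assms(1) by measurable
  show ?thesis
    unfolding Lp_finite_def
    using assms(2) [unfolded Lp_le_def]
    by (intro integrableI_bounded) (auto simp: le_less_trans)
qed

lemma Lp_norm_le_of_Lp_le:
  assumes "u \<in> borel_measurable borel" "Lp_le p u a" "0 \<le> a" "1 \<le> p"
  shows "Lp_norm p u \<le> a"
proof -
  have int: "integrable lborel (\<lambda>x. \<bar>u x\<bar> powr p)"
    using Lp_finite_of_Lp_le [OF assms(1,2)] by (simp add: Lp_finite_def)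
  have "ennreal (LINT x|lborel. \<bar>u x\<bar> powr p) \<le> ennreal (a powr p)"
    using assms(2) unfolding Lp_le_def by (subst nn_integral_eq_integral [symmetric]) (auto simp: int)
  then have "(LINT x|lborel. \<bar>u x\<bar> powr p) \<le> a powr p" by simp
  then have "Lp_norm p u \<le> (a powr p) powr (1 / p)"
    unfolding Lp_norm_def using assms(4) by (intro powr_mono2) auto
  then show ?thesis using assms(3,4) by (simp add: powr_powr)
qed

text \<open>The L^p bounds \<open>b\<close> alone control \<open>g\<close>: by the Sobolev
  inequality \<open>B\<close> bounds the derivatives uniformly, and it also dominates
  \<open>b\<close>, which is the term e = 0 of the sum. One sequence \<open>B\<close> thus serves
  for both kinds of factor.\<close>

lemma Lp_le_compose_of_Lp_bounds:
  fixes F :: "'b::euclidean_space \<Rightarrow> real" and g :: "'a::euclidean_space \<Rightarrow> 'b"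
    and X :: "nat \<Rightarrow> nat \<Rightarrow> real" and b B :: "nat \<Rightarrow> real"
  assumes F: "smooth F" and g: "\<And>j. j \<in> Basis \<Longrightarrow> smooth (\<lambda>x. g x \<bullet> j)" and p: "1 \<le> p"
    and A: "\<And>js y. set js \<subseteq> Basis \<Longrightarrow> js \<noteq> [] \<Longrightarrow> \<bar>iter_frechet F js y\<bar> \<le> X (length js) 0"
    and b: "\<And>k. 1 \<le> k \<Longrightarrow> 0 < b k"
    and B: "\<And>k. 1 \<le> k \<Longrightarrow> 2 ^ (DIM('a) + 1) * (\<Sum>e\<le>DIM('a). b (k + e)) \<le> B k"
    and Lp: "\<And>j vs. j \<in> Basis \<Longrightarrow> set vs \<subseteq> Basis \<Longrightarrow> vs \<noteq> [] \<Longrightarrow>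
      Lp_le p (iter_frechet (\<lambda>x. g x \<bullet> j) vs) (b (length vs))"
    and X: "\<And>s k. DIM('b) * (\<Sum>r\<le>k. (k choose r) * X (Suc s) r * B (Suc (k - r))) \<le> X s (Suc k)"
    and X_nonneg: "\<And>s k. 0 \<le> X s k"
    and vs: "set vs \<subseteq> Basis" "vs \<noteq> []"
  shows "Lp_le p (iter_frechet (\<lambda>x. F (g x)) vs) (X 0 (length vs) * (DIM('b) * Suc (DIM('a)) ^ length vs))"
proof -
  have bB: "b k \<le> B k" if k: "1 \<le> k" for k
  proof -
    have b0: "0 \<le> b (k + e)" for e using b [of "k + e"] k by simp
    have "b k \<le> (\<Sum>e\<le>DIM('a). b (k + e))"
      using member_le_sum [of 0 "{..DIM('a)}" "\<lambda>e. b (k + e)"] b0 by simp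
    moreover have "1 * (\<Sum>e\<le>DIM('a). b (k + e)) \<le> 2 ^ (DIM('a) + 1) * (\<Sum>e\<le>DIM('a). b (k + e))"
    proof (rule mult_right_mono)
      show "1 \<le> (2 :: real) ^ (DIM('a) + 1)" by (rule one_le_power) simp
      show "0 \<le> (\<Sum>e\<le>DIM('a). b (k + e))" by (rule sum_nonneg) (rule b0)
    qed
    ultimately show ?thesis using B [OF k] by linarith
  qed
  have len: "1 \<le> length ws" if "ws \<noteq> []" for ws :: "'a list"
    using that by (simp add: Suc_le_eq)
  show ?thesis
  proof (rule Lp_le_iter_frechet_compose [where F = F and g = g and X = X and B = B, OF F _ p])
    show "0 < B k" if "1 \<le> k" for k using b [OF that] bB [OF that] by linarith
    fix j :: 'b and ws :: "'a list" assume h: "j \<in> Basis" "set ws \<subseteq> Basis" "ws \<noteq> []"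
    show "Lp_le p (iter_frechet (\<lambda>x. g x \<bullet> j) ws) (B (length ws))"
      by (rule Lp_le_mono [OF Lp [OF h] less_imp_le [OF b [OF len [OF h(3)]]] bB [OF len [OF h(3)]]]) (use p in simp)
    have "\<bar>iter_frechet (\<lambda>x. g x \<bullet> j) ws x\<bar> \<le> 2 ^ (DIM('a) + 1) * (\<Sum>e\<le>DIM('a). b (length ws + e))" for x
      by (rule sup_bound_of_Lp_bounds [where c = b, OF g [OF h(1)] p b Lp [OF h(1)] h(2,3)])
    then show "\<bar>iter_frechet (\<lambda>x. g x \<bullet> j) ws x\<bar> \<le> B (length ws)" for x
      using B [OF len [OF h(3)]] by (rule order_trans)
  qed (fact g A X X_nonneg vs | simp)+
qed

section \<open>Multi-indices and the function classes\<close>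

text \<open>The choice in \<open>mi_list\<close> has a witness: over a finite index type every
  \<alpha> is a multiset, and every multiset comes from a list.\<close>

lemma count_list_mi_list: "count_list (mi_list \<alpha>) i = \<alpha> $ i" for \<alpha> :: "nat ^ 'm"
proof -
  obtain xs where xs: "mset xs = Abs_multiset (\<lambda>i. \<alpha> $ i)" using ex_mset by blast
  have "count_list xs i = \<alpha> $ i" for i
    by (simp add: count_mset [symmetric] xs count_Abs_multiset)
  then have "\<forall>i. count_list (mi_list \<alpha>) i = \<alpha> $ i"
    unfolding mi_list_def by (intro someI [of "\<lambda>is. \<forall>i. count_list is i = \<alpha> $ i" xs]) simp
  then show ?thesis by blast
qed

lemma length_mi_list: "length (mi_list \<alpha>) = mi_abs \<alpha>"
  using sum_count_set [of "mi_list \<alpha>" UNIV] by (simp add: mi_abs_def count_list_mi_list)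

lemma axis_1_in_Basis: "axis i (1 :: real) \<in> Basis"
  by (auto simp: Basis_vec_def)

text \<open>Gives one bound for all multi-indices of the same order.\<close>

lemma finite_mi_abs_eq: "finite {\<alpha> :: nat ^ 'm. mi_abs \<alpha> = k}"
proof (rule finite_subset)
  have "\<alpha> = (\<chi> i. count_list (mi_list \<alpha>) i)" for \<alpha> :: "nat ^ 'm"
    by (simp add: vec_eq_iff count_list_mi_list)
  then show "{\<alpha> :: nat ^ 'm. mi_abs \<alpha> = k} \<subseteq> (\<lambda>is. \<chi> i. count_list is i) ` {is. set is \<subseteq> UNIV \<and> length is = k}"
    using length_mi_list by blast
qed (intro finite_imageI finite_lists_length_eq finite)

lemma partial_deriv_eq_iter_frechet:
  obtains vs where "set vs \<subseteq> Basis" "length vs = mi_abs \<alpha>" "\<And>u. partial_deriv \<alpha> u = iter_frechet u vs"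
proof
  show "set (map (\<lambda>i. axis i (1 :: real)) (mi_list \<alpha>)) \<subseteq> Basis" by (auto simp: axis_1_in_Basis)
qed (simp_all add: length_mi_list partial_deriv_def)

text \<open>The given list and the one chosen by \<open>mi_list\<close> agree as multisets, which
  suffices by the symmetry of derivatives.\<close>

lemma iter_frechet_eq_partial_deriv:
  fixes u :: "real ^ 'm \<Rightarrow> real"
  assumes u: "smooth u" and vs: "set vs \<subseteq> Basis"
  obtains \<alpha> where "mi_abs \<alpha> = length vs" "iter_frechet u vs = partial_deriv \<alpha> u"
proof -
  have "\<forall>v\<in>set vs. \<exists>i. v = axis i 1" using vs by (auto simp: Basis_vec_def)
  then have "\<exists>is. vs = map (\<lambda>i. axis i 1) is"
    by (simp add: ex_map_conv)
  then obtain "is" where "is": "vs = map (\<lambda>i. axis i 1) is" by blast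
  define \<alpha> :: "nat ^ 'm" where "\<alpha> = (\<chi> i. count_list is i)"
  have mset: "mset (mi_list \<alpha>) = mset is"
    by (rule multiset_eqI) (simp add: count_mset count_list_mi_list \<alpha>_def)
  show thesis
  proof
    show "mi_abs \<alpha> = length vs"
      using mset_eq_length [OF mset] by (simp add: length_mi_list "is")
    show "iter_frechet u vs = partial_deriv \<alpha> u"
      unfolding partial_deriv_def "is"
      by (rule iter_frechet_mset_cong [OF u]) (simp add: mset)
  qed
qed

lemma smooth_component:
  fixes f :: "'a::euclidean_space \<Rightarrow> real ^ 'n"
  assumes "smooth f"
  shows "smooth (\<lambda>x. f x $ i)" and "iter_frechet (\<lambda>x. f x $ i) vs = (\<lambda>x. iter_frechet f vs x $ i)"
  using smooth_bounded_linear [OF assms bounded_linear_vec_nth]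
    iter_frechet_bounded_linear [OF assms bounded_linear_vec_nth] by blast+

lemma ex_inner_Basis_eq_component:
  fixes g :: "'a::euclidean_space \<Rightarrow> real ^ 'm"
  assumes "j \<in> Basis"
  shows "\<exists>k. \<forall>x. g x \<bullet> j = g x $ k"
proof -
  obtain k where "j = axis k 1" using assms by (auto simp: Basis_vec_def)
  then show ?thesis by (auto simp: cart_eq_inner_axis)
qed

lemma smooth_compose_component:
  fixes f :: "real ^ 'm \<Rightarrow> real ^ 'n" and g :: "'a::euclidean_space \<Rightarrow> real ^ 'm"
  assumes f: "smooth f" and g: "\<And>j. smooth (\<lambda>x. g x $ j)"
  shows "smooth (\<lambda>x. f (g x) $ i)"
proof (rule smooth_compose [OF smooth_component(1) [OF f]])
  fix j :: "real ^ 'm" assume "j \<in> Basis"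
  then obtain k where "\<And>x. g x \<bullet> j = g x $ k" using ex_inner_Basis_eq_component [of j g] by blast
  then show "smooth (\<lambda>x. g x \<bullet> j)" using g by simp
qed

text \<open>The estimate common to all three classes: they differ only in the sequences
  \<open>b\<close>, \<open>B\<close> and the solution \<open>X\<close> of the recursion. The column
  \<open>X k 0\<close> bounds the derivatives of \<open>f\<close>, for k \<ge> 1 only.\<close>

lemma partial_deriv_compose_Lp:
  fixes f :: "real ^ 'm \<Rightarrow> real ^ 'n" and g :: "real ^ 'l \<Rightarrow> real ^ 'm"
    and X :: "nat \<Rightarrow> nat \<Rightarrow> real" and b B :: "nat \<Rightarrow> real"
  assumes f: "smooth f" and g: "\<And>j. smooth (\<lambda>x. g x $ j)" and p: "1 \<le> p"
    and A: "\<And>k y. 1 \<le> k \<Longrightarrow> frechet_norm k f y \<le> X k 0"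
    and b: "\<And>k. 1 \<le> k \<Longrightarrow> 0 < b k"
    and B: "\<And>k. 1 \<le> k \<Longrightarrow> 2 ^ (CARD('l) + 1) * (\<Sum>e\<le>CARD('l). b (k + e)) \<le> B k"
    and Lp: "\<And>j \<alpha>. 1 \<le> mi_abs \<alpha> \<Longrightarrow> Lp_finite p (partial_deriv \<alpha> (\<lambda>x. g x $ j))"
      "\<And>j \<alpha>. 1 \<le> mi_abs \<alpha> \<Longrightarrow> Lp_norm p (partial_deriv \<alpha> (\<lambda>x. g x $ j)) \<le> b (mi_abs \<alpha>)"
    and X: "\<And>s k. CARD('m) * (\<Sum>r\<le>k. (k choose r) * X (Suc s) r * B (Suc (k - r))) \<le> X s (Suc k)"
    and X_nonneg: "\<And>s k. 0 \<le> X s k"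
    and \<alpha>: "1 \<le> mi_abs \<alpha>"
  shows "Lp_finite p (partial_deriv \<alpha> (\<lambda>x. f (g x) $ i))"
    and "Lp_norm p (partial_deriv \<alpha> (\<lambda>x. f (g x) $ i)) \<le> X 0 (mi_abs \<alpha>) * (CARD('m) * Suc (CARD('l)) ^ mi_abs \<alpha>)"
proof -
  define F where "F = (\<lambda>y. f y $ i)"
  have F: "smooth F" unfolding F_def by (rule smooth_component [OF f])
  have g': "smooth (\<lambda>x. g x \<bullet> j)" if j: "j \<in> Basis" for j
  proof -
    obtain k where "\<And>x. g x \<bullet> j = g x $ k"
      using ex_inner_Basis_eq_component [OF j, of g] by blast
    then show ?thesis using g by simp
  qed
  note sm = smooth_compose_component [OF f g]
  obtain vs :: "(real ^ 'l) list" where vs: "set vs \<subseteq> Basis" "length vs = mi_abs \<alpha>"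
    and pd: "\<And>u. partial_deriv \<alpha> u = (iter_frechet u vs :: real ^ 'l \<Rightarrow> real)"
    using partial_deriv_eq_iter_frechet [of \<alpha>] by blast
  have ne: "vs \<noteq> []" using vs(2) \<alpha> by auto
  have "Lp_le p (iter_frechet (\<lambda>x. F (g x)) vs)
      (X 0 (length vs) * (DIM(real ^ 'm) * Suc (DIM(real ^ 'l)) ^ length vs))"
  proof (rule Lp_le_compose_of_Lp_bounds [where F = F and g = g and X = X and b = b and B = B, OF F _ p])
    fix js y assume js: "set js \<subseteq> (Basis :: (real ^ 'm) set)" "js \<noteq> []"
    have "norm (iter_frechet f js y) \<le> frechet_norm (length js) f y"
      using js norm_Basis by (intro iter_frechet_le_frechet_norm f) fastforce
    also have "\<dots> \<le> X (length js) 0" using js by (intro A) (simp add: Suc_le_eq)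
    finally show "\<bar>iter_frechet F js y\<bar> \<le> X (length js) 0"
      unfolding F_def smooth_component(2) [OF f] using component_le_norm_cart [of "iter_frechet f js y" i] by linarith
  next
    fix j :: "real ^ 'm" and ws :: "(real ^ 'l) list" assume h: "j \<in> Basis" "set ws \<subseteq> Basis" "ws \<noteq> []"
    obtain k where k: "\<And>x. g x \<bullet> j = g x $ k" using ex_inner_Basis_eq_component [OF h(1), of g] by blast
    obtain \<beta> where \<beta>: "mi_abs \<beta> = length ws" "iter_frechet (\<lambda>x. g x $ k) ws = partial_deriv \<beta> (\<lambda>x. g x $ k)"
      using iter_frechet_eq_partial_deriv [OF g h(2)] by blast
    have "1 \<le> mi_abs \<beta>" using \<beta>(1) h(3) by (simp add: Suc_le_eq)
    from Lp_le_mono [OF Lp_le_Lp_norm [OF Lp(1) [OF this] p] _ Lp(2) [OF this]]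
    show "Lp_le p (iter_frechet (\<lambda>x. g x \<bullet> j) ws) (b (length ws))"
      unfolding k \<beta>(2) \<beta>(1) [symmetric] using p by (simp add: Lp_norm_def)
  next
    show "2 ^ (DIM(real ^ 'l) + 1) * (\<Sum>e\<le>DIM(real ^ 'l). b (k + e)) \<le> B k" if "1 \<le> k" for k
      using B [OF that] by simp
    show "DIM(real ^ 'm) * (\<Sum>r\<le>k. (k choose r) * X (Suc s) r * B (Suc (k - r))) \<le> X s (Suc k)" for s k
      using X by simp
  qed (fact g' b X_nonneg vs ne)+
  then have Lp_le: "Lp_le p (partial_deriv \<alpha> (\<lambda>x. f (g x) $ i)) (X 0 (mi_abs \<alpha>) * (CARD('m) * Suc (CARD('l)) ^ mi_abs \<alpha>))"
    by (simp add: pd F_def vs(2))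
  have meas: "partial_deriv \<alpha> (\<lambda>x. f (g x) $ i) \<in> borel_measurable borel"
    unfolding pd by (intro smooth_imp_borel smooth_iter_frechet sm)
  show "Lp_finite p (partial_deriv \<alpha> (\<lambda>x. f (g x) $ i))"
    by (rule Lp_finite_of_Lp_le [OF meas Lp_le])
  show "Lp_norm p (partial_deriv \<alpha> (\<lambda>x. f (g x) $ i)) \<le> X 0 (mi_abs \<alpha>) * (CARD('m) * Suc (CARD('l)) ^ mi_abs \<alpha>)"
    by (rule Lp_norm_le_of_Lp_le [OF meas Lp_le _ p]) (simp add: X_nonneg)
qed

section \<open>The classes without weights\<close>

fun majorant_rec :: "real \<Rightarrow> (nat \<Rightarrow> real) \<Rightarrow> (nat \<Rightarrow> real) \<Rightarrow> nat \<Rightarrow> nat \<Rightarrow> real" where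
  "majorant_rec d A B s 0 = A s"
| "majorant_rec d A B s (Suc k) = d * (\<Sum>r\<le>k. (k choose r) * majorant_rec d A B (Suc s) r * B (Suc (k - r)))"

lemma majorant_rec_nonneg:
  assumes "0 \<le> d" "\<And>k. 0 \<le> A k" "\<And>k. 0 \<le> B (Suc k)"
  shows "0 \<le> majorant_rec d A B s k"
proof (induction k arbitrary: s rule: less_induct)
  case (less k)
  then show ?case using assms by (cases k) (auto intro!: mult_nonneg_nonneg sum_nonneg)
qed

text \<open>Only finiteness at each order is claimed, so no growth of the majorants has to be
  controlled and the recursion can be solved as an equality by \<open>majorant_rec\<close>.\<close>

lemma compose_W_inf:
  fixes f :: "real ^ 'm \<Rightarrow> real ^ 'n" and g :: "real ^ 'l \<Rightarrow> real ^ 'm"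
  assumes f: "f \<in> B_ge1" and g: "g \<in> componentwise (W_inf_ge1 p)" and p: "1 \<le> p"
  shows "f \<circ> g \<in> componentwise (W_inf_ge1 p)"
proof -
  have sf: "smooth f" using f by (simp add: B_ge1_def)
  have sg: "smooth (\<lambda>x. g x $ j)" for j using g by (simp add: componentwise_def W_inf_ge1_def)
  have Lp: "Lp_finite p (partial_deriv \<alpha> (\<lambda>x. g x $ j))" if "1 \<le> mi_abs \<alpha>" for \<alpha> j
    using g that by (simp add: componentwise_def W_inf_ge1_def)
  have "\<forall>k. \<exists>a. 1 \<le> k \<longrightarrow> (\<forall>y. frechet_norm k f y \<le> a)"
    using f by (auto simp: B_ge1_def bdd_above_def)
  then obtain a where a: "\<And>k y. 1 \<le> k \<Longrightarrow> frechet_norm k f y \<le> a k" by metis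
  \<comment> \<open>The value \<open>a 0\<close> is arbitrary, as \<open>f\<close> may be unbounded;
    the maximum keeps the majorant nonnegative there too.\<close>
  define A where "A = (\<lambda>k. max 0 (a k))"
  \<comment> \<open>A finite sum dominates each of its terms; the summand 1 makes the bound
    positive.\<close>
  define b where "b = (\<lambda>k. 1 + (\<Sum>j\<in>UNIV. \<Sum>\<alpha> | mi_abs \<alpha> = k. Lp_norm p (partial_deriv \<alpha> (\<lambda>x. g x $ j))))"
  have norm0: "0 \<le> Lp_norm p u" for u :: "real ^ 'l \<Rightarrow> real" by (simp add: Lp_norm_def)
  have b1: "1 \<le> b k" for k unfolding b_def by (simp add: sum_nonneg norm0)
  have b: "Lp_norm p (partial_deriv \<alpha> (\<lambda>x. g x $ j)) \<le> b (mi_abs \<alpha>)" for \<alpha> j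
  proof -
    have "Lp_norm p (partial_deriv \<alpha> (\<lambda>x. g x $ j)) \<le>
        (\<Sum>\<beta> | mi_abs \<beta> = mi_abs \<alpha>. Lp_norm p (partial_deriv \<beta> (\<lambda>x. g x $ j)))"
      by (rule member_le_sum) (auto simp: norm0 finite_mi_abs_eq)
    also have "\<dots> \<le> (\<Sum>j\<in>UNIV. \<Sum>\<beta> | mi_abs \<beta> = mi_abs \<alpha>. Lp_norm p (partial_deriv \<beta> (\<lambda>x. g x $ j)))"
      by (rule member_le_sum [of j]) (auto intro: sum_nonneg simp: norm0)
    finally show ?thesis unfolding b_def by simp
  qed
  define B where "B = (\<lambda>k. 2 ^ (CARD('l) + 1) * (\<Sum>e\<le>CARD('l). b (k + e)))"
  define X where "X = majorant_rec (real CARD('m)) A B"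
  have B0: "0 \<le> B k" for k
    unfolding B_def by (intro mult_nonneg_nonneg sum_nonneg order_trans [OF zero_le_one b1]) auto
  have X0: "0 \<le> X s k" for s k
    unfolding X_def by (rule majorant_rec_nonneg) (auto simp: A_def B0)
  have X: "CARD('m) * (\<Sum>r\<le>k. (k choose r) * X (Suc s) r * B (Suc (k - r))) \<le> X s (Suc k)" for s k
    by (simp add: X_def)
  have A: "frechet_norm k f y \<le> X k 0" if "1 \<le> k" for k y
    using a [OF that, of y] by (simp add: X_def A_def)
  have b0: "0 < b k" for k using b1 [of k] by linarith
  have B: "2 ^ (CARD('l) + 1) * (\<Sum>e\<le>CARD('l). b (k + e)) \<le> B k" for k
    by (simp add: B_def)
  have "Lp_finite p (partial_deriv \<alpha> (\<lambda>x. f (g x) $ i))" if "1 \<le> mi_abs \<alpha>" for \<alpha> i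
    by (rule partial_deriv_compose_Lp [where X = X and b = b and B = B];
        (rule sf sg p A b0 B Lp b X X0 that)?; assumption?)
  then show ?thesis
    using smooth_compose_component [OF sf sg] by (simp add: componentwise_def W_inf_ge1_def)
qed

section \<open>The weighted classes\<close>

lemma W_boundedD:
  assumes M: "weight_sequence M" and "0 < \<sigma>" "W_bounded M p \<sigma> u"
  obtains C where "0 < C" "\<And>\<alpha>. 1 \<le> mi_abs \<alpha> \<Longrightarrow> Lp_finite p (partial_deriv \<alpha> u)"
    "\<And>\<alpha>. 1 \<le> mi_abs \<alpha> \<Longrightarrow> Lp_norm p (partial_deriv \<alpha> u) \<le> C * \<sigma> ^ mi_abs \<alpha> * fact (mi_abs \<alpha>) * M (mi_abs \<alpha>)"
proof -
  have pos: "0 < M k" for k using M by (simp add: weight_sequence_def)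
  obtain C where C: "\<And>\<alpha>. 1 \<le> mi_abs \<alpha> \<Longrightarrow>
      Lp_norm p (partial_deriv \<alpha> u) / (\<sigma> ^ mi_abs \<alpha> * fact (mi_abs \<alpha>) * M (mi_abs \<alpha>)) \<le> C"
    using assms(3) unfolding W_bounded_def bdd_above_def by blast
  show thesis
  proof
    show "0 < max 1 C" by simp
    show "Lp_finite p (partial_deriv \<alpha> u)" if "1 \<le> mi_abs \<alpha>" for \<alpha>
      using assms(3) that by (simp add: W_bounded_def)
    fix \<alpha> :: "nat ^ 'a" assume \<alpha>: "1 \<le> mi_abs \<alpha>"
    have "0 < \<sigma> ^ mi_abs \<alpha> * fact (mi_abs \<alpha>) * M (mi_abs \<alpha>)"
      using assms(2) pos by simp
    moreover have "Lp_norm p (partial_deriv \<alpha> u) / (\<sigma> ^ mi_abs \<alpha> * fact (mi_abs \<alpha>) * M (mi_abs \<alpha>)) \<le> max 1 C"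
      using C [OF \<alpha>] by simp
    ultimately show "Lp_norm p (partial_deriv \<alpha> u) \<le> max 1 C * \<sigma> ^ mi_abs \<alpha> * fact (mi_abs \<alpha>) * M (mi_abs \<alpha>)"
      by (simp only: pos_divide_le_eq mult.assoc)
  qed
qed

lemma W_boundedI:
  assumes M: "weight_sequence M" and "0 < \<sigma>"
    and "\<And>\<alpha>. 1 \<le> mi_abs \<alpha> \<Longrightarrow> Lp_finite p (partial_deriv \<alpha> u)"
    and C: "\<And>\<alpha>. 1 \<le> mi_abs \<alpha> \<Longrightarrow> Lp_norm p (partial_deriv \<alpha> u) \<le> C * \<sigma> ^ mi_abs \<alpha> * fact (mi_abs \<alpha>) * M (mi_abs \<alpha>)"
  shows "W_bounded M p \<sigma> u"
  unfolding W_bounded_def bdd_above_def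
proof (intro conjI exI [of _ C] ballI allI impI)
  have pos: "0 < M k" for k using M by (simp add: weight_sequence_def)
  fix z assume "z \<in> {Lp_norm p (partial_deriv \<alpha> u) / (\<sigma> ^ mi_abs \<alpha> * fact (mi_abs \<alpha>) * M (mi_abs \<alpha>)) |\<alpha>. 1 \<le> mi_abs \<alpha>}"
  then obtain \<alpha> where \<alpha>: "1 \<le> mi_abs \<alpha>"
    and z: "z = Lp_norm p (partial_deriv \<alpha> u) / (\<sigma> ^ mi_abs \<alpha> * fact (mi_abs \<alpha>) * M (mi_abs \<alpha>))" by blast
  have "0 < \<sigma> ^ mi_abs \<alpha> * fact (mi_abs \<alpha>) * M (mi_abs \<alpha>)"
    using assms(2) pos by simp
  then show "z \<le> C" unfolding z using C [OF \<alpha>] by (simp only: pos_divide_le_eq mult.assoc)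
qed (fact assms(3))

text \<open>Brings the components of \<open>g\<close> to a common radius in the Roumieu
  case.\<close>

lemma W_bounded_mono:
  assumes M: "weight_sequence M" and "0 < \<sigma>" "\<sigma> \<le> \<tau>" "W_bounded M p \<sigma> u"
  shows "W_bounded M p \<tau> u"
proof -
  have pos: "0 < M k" for k using M by (simp add: weight_sequence_def)
  obtain C where C: "0 < C" "\<And>\<alpha>. 1 \<le> mi_abs \<alpha> \<Longrightarrow> Lp_finite p (partial_deriv \<alpha> u)"
    "\<And>\<alpha>. 1 \<le> mi_abs \<alpha> \<Longrightarrow> Lp_norm p (partial_deriv \<alpha> u) \<le> C * \<sigma> ^ mi_abs \<alpha> * fact (mi_abs \<alpha>) * M (mi_abs \<alpha>)"
    using W_boundedD [OF M assms(2,4)] by blast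
  show ?thesis
  proof (rule W_boundedI [OF M _ C(2)])
    fix \<alpha> :: "nat ^ 'a" assume \<alpha>: "1 \<le> mi_abs \<alpha>"
    have "C * \<sigma> ^ mi_abs \<alpha> * fact (mi_abs \<alpha>) * M (mi_abs \<alpha>) \<le> C * \<tau> ^ mi_abs \<alpha> * fact (mi_abs \<alpha>) * M (mi_abs \<alpha>)"
      using assms(2,3) C(1) pos [of "mi_abs \<alpha>"] by (intro mult_right_mono mult_left_mono power_mono) auto
    with C(3) [OF \<alpha>] show "Lp_norm p (partial_deriv \<alpha> u) \<le> C * \<tau> ^ mi_abs \<alpha> * fact (mi_abs \<alpha>) * M (mi_abs \<alpha>)"
      by linarith
  qed (use assms in auto)
qed

lemma B_boundedD:
  assumes M: "weight_sequence M" and "0 < \<rho>" "B_bounded M \<rho> f"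
  obtains C where "0 \<le> C" "\<And>k x. 1 \<le> k \<Longrightarrow> frechet_norm k f x \<le> C * \<rho> ^ k * fact k * M k"
proof -
  have pos: "0 < M k" for k using M by (simp add: weight_sequence_def)
  obtain C where C: "\<And>k x. 1 \<le> k \<Longrightarrow> frechet_norm k f x / (\<rho> ^ k * fact k * M k) \<le> C"
    using assms(3) unfolding B_bounded_def bdd_above_def by blast
  show thesis
  proof
    show "0 \<le> max 0 C" by simp
    fix k x assume k: "1 \<le> (k :: nat)"
    have "0 < \<rho> ^ k * fact k * M k" using assms(2) pos by simp
    moreover have "frechet_norm k f x / (\<rho> ^ k * fact k * M k) \<le> max 0 C" using C [OF k, of x] by simp
    ultimately show "frechet_norm k f x \<le> max 0 C * \<rho> ^ k * fact k * M k"
      by (simp only: pos_divide_le_eq mult.assoc)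
  qed
qed

text \<open>The order of quantifiers matters: \<open>K\<close> is obtained from \<open>g\<close> and
  \<sigma> before \<open>f\<close> and \<rho> are given. The Roumieu case takes any \<rho> that
  works for \<open>f\<close>, while the Beurling case chooses \<rho> in terms of
  \<open>K\<close>.\<close>

lemma compose_W_bounded:
  fixes g :: "real ^ 'l \<Rightarrow> real ^ 'm" and M :: "nat \<Rightarrow> real"
  assumes M: "weight_sequence M" "log_convex M"
    and H: "1 \<le> H" "\<forall>k\<ge>1. \<forall>e. M (k + e) \<le> H ^ (e * (k + e)) * M k"
    and p: "1 \<le> p" and \<sigma>: "0 < \<sigma>"
    and g: "\<And>j. smooth (\<lambda>x. g x $ j)" "\<And>j. W_bounded M p \<sigma> (\<lambda>x. g x $ j)"
  obtains K where "0 < K"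
    "\<And>(f :: real ^ 'm \<Rightarrow> real ^ 'n) \<rho> i. smooth f \<Longrightarrow> 0 < \<rho> \<Longrightarrow> B_bounded M \<rho> f \<Longrightarrow>
      smooth (\<lambda>x. f (g x) $ i) \<and>
      W_bounded M p (2 * H ^ CARD('l) * \<sigma> * (2 + K * \<rho>) * Suc (CARD('l))) (\<lambda>x. f (g x) $ i)"
proof -
  let ?d = "CARD('l)"
  have pos: "0 < M k" for k using M by (simp add: weight_sequence_def)
  have "\<exists>C. 0 < C \<and> (\<forall>\<alpha>. 1 \<le> mi_abs \<alpha> \<longrightarrow>
     Lp_norm p (partial_deriv \<alpha> (\<lambda>x. g x $ j)) \<le> C * \<sigma> ^ mi_abs \<alpha> * fact (mi_abs \<alpha>) * M (mi_abs \<alpha>))" for j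
    using W_boundedD [OF M(1) \<sigma> g(2)] by blast
  then obtain C' where C': "\<And>j. 0 < C' j" "\<And>j \<alpha>. 1 \<le> mi_abs \<alpha> \<Longrightarrow>
     Lp_norm p (partial_deriv \<alpha> (\<lambda>x. g x $ j)) \<le> C' j * \<sigma> ^ mi_abs \<alpha> * fact (mi_abs \<alpha>) * M (mi_abs \<alpha>)"
    by metis
  have Lp: "Lp_finite p (partial_deriv \<alpha> (\<lambda>x. g x $ j))" if "1 \<le> mi_abs \<alpha>" for \<alpha> j
    using g(2) that by (simp add: W_bounded_def)
  define C where "C = (\<Sum>j\<in>UNIV. C' j)"
  have C: "0 < C" unfolding C_def using C'(1) by (intro sum_pos) auto
  have "C' j \<le> C" for j
    unfolding C_def using C'(1) by (intro member_le_sum) (auto intro: less_imp_le)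
  then have "C' j * (\<sigma> ^ k * fact k * M k) \<le> C * (\<sigma> ^ k * fact k * M k)" for j k
    using \<sigma> pos [of k] by (intro mult_right_mono) auto
  define b where "b = (\<lambda>k. C * \<sigma> ^ k * fact k * M k)"
  have b: "Lp_norm p (partial_deriv \<alpha> (\<lambda>x. g x $ j)) \<le> b (mi_abs \<alpha>)" if "1 \<le> mi_abs \<alpha>" for \<alpha> j
    using C'(2) [OF that, of j] \<open>C' j * (\<sigma> ^ mi_abs \<alpha> * fact (mi_abs \<alpha>) * M (mi_abs \<alpha>)) \<le> _\<close>
    unfolding b_def by (simp only: mult.assoc)
  have b0: "0 < b k" for k unfolding b_def using C \<sigma> pos by simp
  define C2 where "C2 = 2 ^ (?d + 1) * (\<Sum>e\<le>?d. C * \<sigma> ^ e * 2 ^ e * fact e * H ^ (?d * ?d))"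
  define \<sigma>2 where "\<sigma>2 = 2 * H ^ ?d * \<sigma>"
  have \<sigma>2: "0 < \<sigma>2" unfolding \<sigma>2_def using \<sigma> H(1) by simp
  have C2: "0 < C2" unfolding C2_def using C \<sigma> H(1) by (intro mult_pos_pos sum_pos) auto
  define B where "B = (\<lambda>k. C2 * \<sigma>2 ^ k * fact k * M k)"
  have B: "2 ^ (?d + 1) * (\<Sum>e\<le>?d. b (k + e)) \<le> B k" if "1 \<le> k" for k
  proof -
    have "2 ^ (?d + 1) * (\<Sum>e\<le>?d. b (k + e)) \<le> 2 ^ (?d + 1) *
      ((\<Sum>e\<le>?d. C * \<sigma> ^ e * 2 ^ e * fact e * H ^ (?d * ?d)) * \<sigma>2 ^ k * fact k * M k)"
      unfolding b_def \<sigma>2_def by (intro mult_left_mono weight_shift_sum_le [OF H M(1) C \<sigma> that]) simp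
    also have "\<dots> = B k" unfolding B_def C2_def by (simp only: mult.assoc)
    finally show ?thesis .
  qed
  \<comment> \<open>Chosen so that 2 + K \<rho> is the number c of the composition majorant; \<rho>
    is thereby factored out.\<close>
  define K where "K = 4 * (real CARD('m) * C2 * M 1)"
  have K: "0 < K" unfolding K_def using C2 pos by simp
  show thesis
  proof (rule that [OF K])
    fix f :: "real ^ 'm \<Rightarrow> real ^ 'n" and \<rho> i
    assume f: "smooth f" and \<rho>: "0 < \<rho>" and "B_bounded M \<rho> f"
    then obtain A where A: "0 \<le> A" "\<And>k x. 1 \<le> k \<Longrightarrow> frechet_norm k f x \<le> A * \<rho> ^ k * fact k * M k"
      using B_boundedD [OF M(1)] by blast
    define c where "c = 2 + K * \<rho>"
    have c: "c = 2 + 4 * (real CARD('m) * \<rho> * C2 * M 1)" by (simp add: c_def K_def)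
    have c0: "0 < c" unfolding c_def using K \<rho> by (simp add: add_pos_pos)
    define X where "X = (\<lambda>s k. A * M (s + k) * \<rho> ^ s * (\<sigma>2 * c) ^ k * fact (s + k))"
    have X: "CARD('m) * (\<Sum>r\<le>k. (k choose r) * X (Suc s) r * B (Suc (k - r))) \<le> X s (Suc k)" for s k
      unfolding X_def B_def by (rule composition_majorant [OF M \<rho> \<sigma>2 C2 A(1) c])
    have X0: "0 \<le> X s k" for s k
      unfolding X_def using A(1) \<rho> \<sigma>2 c0 pos [of "s + k"] by simp
    have AX: "frechet_norm k f y \<le> X k 0" if "1 \<le> k" for k y
      using A(2) [OF that, of y] unfolding X_def by (simp add: mult_ac)
    have concl: "Lp_finite p (partial_deriv \<alpha> (\<lambda>x. f (g x) $ i))"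
      "Lp_norm p (partial_deriv \<alpha> (\<lambda>x. f (g x) $ i)) \<le> X 0 (mi_abs \<alpha>) * (CARD('m) * Suc ?d ^ mi_abs \<alpha>)"
      if "1 \<le> mi_abs \<alpha>" for \<alpha>
      by (rule partial_deriv_compose_Lp [where X = X and b = b and B = B];
          (rule f g(1) p AX b0 B Lp b X X0 that)?; assumption?)+
    \<comment> \<open>The count of lists, \<open>Suc ?d ^ mi_abs \<alpha>\<close>, is geometric in
      the order and goes into the radius; \<open>CARD('m)\<close> goes into the constant.\<close>
    define \<tau> where "\<tau> = \<sigma>2 * c * Suc ?d"
    have \<tau>: "0 < \<tau>" unfolding \<tau>_def using \<sigma>2 c0 by simp
    have "W_bounded M p \<tau> (\<lambda>x. f (g x) $ i)"
    proof (rule W_boundedI [OF M(1) \<tau> concl(1)])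
      fix \<alpha> :: "nat ^ 'l" assume \<alpha>: "1 \<le> mi_abs \<alpha>"
      have eq: "X 0 (mi_abs \<alpha>) * (CARD('m) * Suc ?d ^ mi_abs \<alpha>) = A * real CARD('m) * \<tau> ^ mi_abs \<alpha> * fact (mi_abs \<alpha>) * M (mi_abs \<alpha>)"
        unfolding X_def \<tau>_def by (simp add: power_mult_distrib mult_ac del: of_nat_Suc)
      show "Lp_norm p (partial_deriv \<alpha> (\<lambda>x. f (g x) $ i)) \<le>
          A * real CARD('m) * \<tau> ^ mi_abs \<alpha> * fact (mi_abs \<alpha>) * M (mi_abs \<alpha>)"
        using concl(2) [OF \<alpha>] unfolding eq .
    qed
    then show "smooth (\<lambda>x. f (g x) $ i) \<and>
      W_bounded M p (2 * H ^ ?d * \<sigma> * (2 + K * \<rho>) * Suc ?d) (\<lambda>x. f (g x) $ i)"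
      using smooth_compose_component [OF f g(1)] unfolding \<tau>_def \<sigma>2_def c_def by blast
  qed
qed


theorem mainTheorem12:
  fixes M :: "nat \<Rightarrow> real" and p :: real
    and f :: "real ^ 'm \<Rightarrow> real ^ 'n" and g :: "real ^ 'l \<Rightarrow> real ^ 'm"
  assumes "weight_sequence M" and "log_convex M" and "derivation_closed M"
    and "1 \<le> p"
  shows "(f \<in> B_ge1 \<and> g \<in> componentwise (W_inf_ge1 p)
            \<longrightarrow> f \<circ> g \<in> componentwise (W_inf_ge1 p))
       \<and> (f \<in> B_Beurling_ge1 M \<and> g \<in> componentwise (W_Beurling_ge1 M p)
            \<longrightarrow> f \<circ> g \<in> componentwise (W_Beurling_ge1 M p))
       \<and> (f \<in> B_Roumieu_ge1 M \<and> g \<in> componentwise (W_Roumieu_ge1 M p)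
            \<longrightarrow> f \<circ> g \<in> componentwise (W_Roumieu_ge1 M p))"
proof (intro conjI impI; elim conjE)
  show "f \<circ> g \<in> componentwise (W_inf_ge1 p)" if "f \<in> B_ge1" "g \<in> componentwise (W_inf_ge1 p)"
    using compose_W_inf that assms(4) by blast
next
  obtain H where H: "1 \<le> H" "\<forall>k\<ge>1. \<forall>e. M (k + e) \<le> H ^ (e * (k + e)) * M k"
    using derivation_closed_shift [OF assms(1,3)] by blast
  note compose = compose_W_bounded [OF assms(1,2) H assms(4)]
  \<comment> \<open>The factor by which the radius grows when K \<rho> = 1, so that 2 + K \<rho> =
    3.\<close>
  let ?D = "2 * H ^ CARD('l) * 3 * Suc (CARD('l))"
  have D: "0 < ?D" using H(1) by simp
  {
    assume f: "f \<in> B_Beurling_ge1 M" and g: "g \<in> componentwise (W_Beurling_ge1 M p)"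
    have sg: "smooth (\<lambda>x. g x $ j)" for j
      using g by (simp add: componentwise_def W_Beurling_ge1_def)
    have "smooth (\<lambda>x. f (g x) $ i) \<and> W_bounded M p \<tau> (\<lambda>x. f (g x) $ i)" if \<tau>: "0 < \<tau>" for \<tau> i
    proof -
      \<comment> \<open>The target radius \<tau> determines \<sigma>; only then is \<open>K\<close>
        known, and \<rho> = 1/K is admissible because \<open>f\<close> is bounded for every
        \<rho>.\<close>
      define \<sigma> where "\<sigma> = \<tau> / ?D"
      have \<sigma>: "0 < \<sigma>" unfolding \<sigma>_def using \<tau> D by (rule divide_pos_pos)
      have "W_bounded M p \<sigma> (\<lambda>x. g x $ j)" for j
        using g \<sigma> by (simp add: componentwise_def W_Beurling_ge1_def)
      from compose [OF \<sigma> sg this] obtain K where K: "0 < K"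
        "\<And>(f :: real ^ 'm \<Rightarrow> real ^ 'n) \<rho> i. smooth f \<Longrightarrow> 0 < \<rho> \<Longrightarrow> B_bounded M \<rho> f \<Longrightarrow>
          smooth (\<lambda>x. f (g x) $ i) \<and>
          W_bounded M p (2 * H ^ CARD('l) * \<sigma> * (2 + K * \<rho>) * Suc (CARD('l))) (\<lambda>x. f (g x) $ i)"
        by blast
      have "2 * H ^ CARD('l) * \<sigma> * (2 + K * (1 / K)) * Suc (CARD('l)) = ?D * \<sigma>"
        using K(1) by (simp add: mult_ac)
      also have "\<dots> = \<tau>" unfolding \<sigma>_def using H(1) by auto
      finally have eq: "2 * H ^ CARD('l) * \<sigma> * (2 + K * (1 / K)) * Suc (CARD('l)) = \<tau>" .
      have "smooth f" "B_bounded M (1 / K) f"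
        using f K(1) by (simp_all add: B_Beurling_ge1_def)
      from K(2) [OF this(1) _ this(2), of i] K(1) show ?thesis unfolding eq by simp
    qed
    from this this [OF zero_less_one] show "f \<circ> g \<in> componentwise (W_Beurling_ge1 M p)"
      by (simp add: componentwise_def W_Beurling_ge1_def)
  next
    assume f: "f \<in> B_Roumieu_ge1 M" and g: "g \<in> componentwise (W_Roumieu_ge1 M p)"
    have sg: "smooth (\<lambda>x. g x $ j)" for j
      using g by (simp add: componentwise_def W_Roumieu_ge1_def)
    have "\<forall>j. \<exists>\<sigma>>0. W_bounded M p \<sigma> (\<lambda>x. g x $ j)"
      using g by (simp add: componentwise_def W_Roumieu_ge1_def)
    then obtain s where s: "\<And>j. 0 < s j" "\<And>j. W_bounded M p (s j) (\<lambda>x. g x $ j)"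
      by metis
    \<comment> \<open>A radius that is at least that of each of the finitely many
      components.\<close>
    define \<sigma> where "\<sigma> = (\<Sum>j\<in>UNIV. s j)"
    have \<sigma>: "0 < \<sigma>" unfolding \<sigma>_def using s(1) by (intro sum_pos) auto
    have "s j \<le> \<sigma>" for j
      unfolding \<sigma>_def using s(1) by (intro member_le_sum) (auto intro: less_imp_le)
    then have "W_bounded M p \<sigma> (\<lambda>x. g x $ j)" for j
      by (rule W_bounded_mono [OF assms(1) s(1) _ s(2)])
    from compose [OF \<sigma> sg this] obtain K where K: "0 < K"
        "\<And>(f :: real ^ 'm \<Rightarrow> real ^ 'n) \<rho> i. smooth f \<Longrightarrow> 0 < \<rho> \<Longrightarrow> B_bounded M \<rho> f \<Longrightarrow>
          smooth (\<lambda>x. f (g x) $ i) \<and>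
          W_bounded M p (2 * H ^ CARD('l) * \<sigma> * (2 + K * \<rho>) * Suc (CARD('l))) (\<lambda>x. f (g x) $ i)"
      by blast
    obtain \<rho> where \<rho>: "0 < \<rho>" "B_bounded M \<rho> f" and sf: "smooth f"
      using f by (auto simp: B_Roumieu_ge1_def)
    have "0 < 2 * H ^ CARD('l) * \<sigma> * (2 + K * \<rho>) * Suc (CARD('l))"
      using H(1) \<sigma> K(1) \<rho>(1) by (simp add: add_pos_pos)
    with K(2) [OF sf \<rho>] show "f \<circ> g \<in> componentwise (W_Roumieu_ge1 M p)"
      unfolding componentwise_def W_Roumieu_ge1_def comp_def by blast
  }
qed

end
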